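(* Let $\theta\in(0,1)$ be irrational, let $h:\mathbb{R}\to\mathbb{R}$ be even, smooth and exponentially decaying, let $\mathbb{P}_0$ be a compactly supported Borel probability measure on $\mathbb{R}$, and let $H_R(b,\omega_1,\omega_2)$ be the random incommensurate coupled chain operators on $\ell^2(\mathbb{Z})\oplus\ell^2(\mathbb{Z})$. Then there exists a set $\Sigma_R\subset\mathbb{R}$ such that the set $$\left\{(b,\omega_1,\omega_2)\in\mathbb{R}\times\mathbb{R}^{\mathbb{Z}}\times\mathbb{R}^{\mathbb{Z}}:\sigma(H_R(b,\omega_1,\omega_2))=\Sigma_R\right\}$$ has full measure in $\mathbb{R}\times\mathbb{R}^{\mathbb{Z}}\times\mathbb{R}^{\mathbb{Z}}$ with respect to the product measure (Lebesgue measure on $\mathbb{R}$ times $\mathbb{P}\times\mathbb{P}$), i.e. its complement is a null set.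
   Context: Elements of $\ell^2(\mathbb{Z})\oplus\ell^2(\mathbb{Z})$ are written $\psi=(\psi_1,\psi_2)$, $\psi_i=(\psi_{in})_{n\in\mathbb{Z}}$, with the natural inner product. $(\Delta\phi)_n:=\phi_{n+1}-2\phi_n+\phi_{n-1}$. Exponentially decaying means $|h(\eta)|\le Ce^{-c|\eta|}$ for some $C,c>0$. Let $\mathbb{P}$ be the product probability measure of copies of $\mathbb{P}_0$ on $\mathbb{R}^{\mathbb{Z}}$ with the product Borel $\sigma$-algebra. For $b\in\mathbb{R}$ and $\omega_i=(\omega_{ij})_{j\in\mathbb{Z}}\in\mathbb{R}^{\mathbb{Z}}$, $i\in\{1,2\}$, the random incommensurate coupled chain operator is the self-adjoint operator $$(H_R(b,\omega_1,\omega_2)\psi)_{1n}=-(\Delta\psi_1)_n+\omega_{1n}\psi_{1n}+\sum_{n'\in\mathbb{Z}}h(n-(1-\theta)n'-b)\psi_{2n'},$$ $$(H_R(b,\omega_1,\omega_2)\psi)_{2n}=-(\Delta\psi_2)_n+\omega_{2n}\psi_{2n}+\sum_{n'\in\mathbb{Z}}h((1-\theta)n+b-n')\psi_{1n'}.$$ (Since $\mathbb{P}_0$ is compactly supported, almost surely all $\omega_{ij}$ lie in a fixed compact set and the operator is bounded; for other $\omega_1,\omega_2$ it is taken on its maximal domain.) $\sigma(\cdot)$ denotes the spectrum. *)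

theory Defs
  imports "HOL-Probability.Probability"
begin

definition ell2 :: "(int \<Rightarrow> complex) set" where
  "ell2 = {\<phi>. (\<lambda>n. (cmod (\<phi> n))\<^sup>2) summable_on UNIV}"

type_synonym chain_pair = "(int \<Rightarrow> complex) \<times> (int \<Rightarrow> complex)"

definition ell2_sum :: "chain_pair set" where
  "ell2_sum = ell2 \<times> ell2"

text \<open>The norm of the natural inner product; it is meaningful on \<open>ell2_sum\<close> only.\<close>

definition ell2_norm :: "chain_pair \<Rightarrow> real" where
  "ell2_norm \<psi> = sqrt ((\<Sum>\<^sub>\<infinity>n. (cmod (fst \<psi> n))\<^sup>2) + (\<Sum>\<^sub>\<infinity>n. (cmod (snd \<psi> n))\<^sup>2))"

text \<open>An operator is a domain \<open>D\<close> together with a map \<open>T\<close> that is relevant on \<open>D\<close> only.\<close>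

definition shifted_op :: "(chain_pair \<Rightarrow> chain_pair) \<Rightarrow> complex \<Rightarrow> chain_pair \<Rightarrow> chain_pair" where
  "shifted_op T z \<psi> =
     ((\<lambda>n. fst (T \<psi>) n - z * fst \<psi> n), (\<lambda>n. snd (T \<psi>) n - z * snd \<psi> n))"

definition resolvent_set :: "chain_pair set \<Rightarrow> (chain_pair \<Rightarrow> chain_pair) \<Rightarrow> complex set" where
  "resolvent_set D T =
     {z. bij_betw (shifted_op T z) D ell2_sum \<and>
         (\<exists>C. \<forall>\<eta>\<in>ell2_sum. ell2_norm (inv_into D (shifted_op T z) \<eta>) \<le> C * ell2_norm \<eta>)}"

definition op_spectrum :: "chain_pair set \<Rightarrow> (chain_pair \<Rightarrow> chain_pair) \<Rightarrow> complex set" where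
  "op_spectrum D T = - resolvent_set D T"

definition discrete_laplacian :: "(int \<Rightarrow> complex) \<Rightarrow> int \<Rightarrow> complex" where
  "discrete_laplacian \<phi> n = \<phi> (n + 1) - 2 * \<phi> n + \<phi> (n - 1)"

definition coupled_chain ::
  "(real \<Rightarrow> real) \<Rightarrow> real \<Rightarrow> real \<Rightarrow> (int \<Rightarrow> real) \<Rightarrow> (int \<Rightarrow> real) \<Rightarrow> chain_pair \<Rightarrow> chain_pair" where
  "coupled_chain h \<theta> b \<omega>\<^sub>1 \<omega>\<^sub>2 \<psi> =
     ((\<lambda>n. - discrete_laplacian (fst \<psi>) n + complex_of_real (\<omega>\<^sub>1 n) * fst \<psi> n
           + (\<Sum>\<^sub>\<infinity>n'. complex_of_real (h (of_int n - (1 - \<theta>) * of_int n' - b)) * snd \<psi> n')),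
      (\<lambda>n. - discrete_laplacian (snd \<psi>) n + complex_of_real (\<omega>\<^sub>2 n) * snd \<psi> n
           + (\<Sum>\<^sub>\<infinity>n'. complex_of_real (h ((1 - \<theta>) * of_int n + b - of_int n')) * fst \<psi> n')))"

text \<open>The maximal domain; it is all of \<open>ell2_sum\<close> when both potentials are bounded.\<close>

definition coupled_chain_domain ::
  "(real \<Rightarrow> real) \<Rightarrow> real \<Rightarrow> real \<Rightarrow> (int \<Rightarrow> real) \<Rightarrow> (int \<Rightarrow> real) \<Rightarrow> chain_pair set" where
  "coupled_chain_domain h \<theta> b \<omega>\<^sub>1 \<omega>\<^sub>2 =
     {\<psi> \<in> ell2_sum. coupled_chain h \<theta> b \<omega>\<^sub>1 \<omega>\<^sub>2 \<psi> \<in> ell2_sum}"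

definition coupled_chain_spectrum ::
  "(real \<Rightarrow> real) \<Rightarrow> real \<Rightarrow> real \<Rightarrow> (int \<Rightarrow> real) \<Rightarrow> (int \<Rightarrow> real) \<Rightarrow> complex set" where
  "coupled_chain_spectrum h \<theta> b \<omega>\<^sub>1 \<omega>\<^sub>2 =
     op_spectrum (coupled_chain_domain h \<theta> b \<omega>\<^sub>1 \<omega>\<^sub>2) (coupled_chain h \<theta> b \<omega>\<^sub>1 \<omega>\<^sub>2)"

definition even_function :: "(real \<Rightarrow> real) \<Rightarrow> bool" where
  "even_function h \<longleftrightarrow> (\<forall>x. h (- x) = h x)"

definition smooth_function :: "(real \<Rightarrow> real) \<Rightarrow> bool" where
  "smooth_function h \<longleftrightarrow> (\<forall>k x. (deriv ^^ k) h differentiable (at x))"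

definition exponentially_decaying :: "(real \<Rightarrow> real) \<Rightarrow> bool" where
  "exponentially_decaying h \<longleftrightarrow> (\<exists>C>0. \<exists>c>0. \<forall>\<eta>. \<bar>h \<eta>\<bar> \<le> C * exp (- c * \<bar>\<eta>\<bar>))"

definition compactly_supported :: "real measure \<Rightarrow> bool" where
  "compactly_supported M \<longleftrightarrow> (\<exists>K. compact K \<and> emeasure M (- K) = 0)"

definition site_product :: "real measure \<Rightarrow> (int \<Rightarrow> real) measure" where
  "site_product P\<^sub>0 = (\<Pi>\<^sub>M j\<in>UNIV. P\<^sub>0)"

text \<open>Lebesgue measure times two copies of the product measure, completed, so that its null sets
  are all subsets of measurable sets of measure zero.\<close>

definition parameter_measure ::
  "real measure \<Rightarrow> (real \<times> (int \<Rightarrow> real) \<times> (int \<Rightarrow> real)) measure" where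
  "parameter_measure P\<^sub>0 =
     completion (lborel \<Otimes>\<^sub>M (site_product P\<^sub>0 \<Otimes>\<^sub>M site_product P\<^sub>0))"

end

theory Submission
  imports Defs
begin

text \<open>Put \<open>a = 1 - \<theta>\<close>. Translating the first chain by \<open>k\<close> and the second by \<open>l\<close> turns the operator at
  \<open>(b, \<omega>\<^sub>1, \<omega>\<^sub>2)\<close> into the one at \<open>(b - k + a l, \<omega>\<^sub>1(\<cdot> + k), \<omega>\<^sub>2(\<cdot> + l))\<close>. Since \<open>a\<close> is irrational, for every target
  \<open>\<beta>\<close> and every \<open>\<epsilon> > 0\<close> there are infinitely many pairs with \<open>\<bar>k - a l - \<beta>\<bar> < \<epsilon>\<close>, so by independence almost
  every \<open>(\<omega>\<^sub>1, \<omega>\<^sub>2)\<close> shows every finite pattern of positive probability at such a pair. Hence for almost every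
  \<open>\<omega>\<close>, all \<open>b\<close>, \<open>b'\<close> and almost every \<open>\<omega>'\<close> some translates of the operator at \<open>(b, \<omega>)\<close> converge strongly to the
  operator at \<open>(b', \<omega>')\<close>. A self-adjoint operator has \<open>z\<close> in its resolvent set iff \<open>H - z\<close> is bounded below, and
  lower bounds survive strong limits, so \<open>\<sigma>(H(b', \<omega>')) \<subseteq> \<sigma>(H(b, \<omega>))\<close>; by symmetry the two spectra are equal.\<close>

section \<open>The Hilbert space of square-summable functions\<close>

text \<open>The shift of \<open>b\<close> and the two random patterns have to be matched at one and
  the same pair \<open>(k, l)\<close>, and the pairs with \<open>k - a l\<close> near a target form
  a thin set: fixing one entry leaves only finitely many values of the other. This finiteness is
  what allows the two chains to be treated in succession. For almost every
  \<open>\<omega>\<^sub>1\<close> infinitely many first entries are suitable; they belong to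
  infinitely many second entries, and among these the independent second chain finds its pattern.
  One null set of potentials has to serve all \<open>b\<close> and all target configurations, which
  are uncountably many. All requirements are therefore cut down to countably many, with rational
  targets and rational patterns, and none of them mentions \<open>b\<close>. The resulting spectrum
  is the same for every \<open>b\<close> once \<open>(\<omega>\<^sub>1, \<omega>\<^sub>2)\<close>
  avoids that null set. On the operator side, a concrete complete inner product type makes the
  Banach fixed point theorem available for surjectivity, and kernels controlled entrywise let the
  potentials and the coupling converge by dominated convergence.\<close>

typedef 'a l2 = "{f :: 'a \<Rightarrow> complex. (\<lambda>x. (cmod (f x))\<^sup>2) summable_on UNIV}"
  morphisms coord Abs_l2
  by (rule exI[of _ "\<lambda>_. 0"]) simp

setup_lifting type_definition_l2

lemma coord_square_summable: "(\<lambda>x. (cmod (coord f x))\<^sup>2) summable_on UNIV"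
  using coord[of f] by simp

lemma square_summable_add:
  fixes f g :: "'a \<Rightarrow> complex"
  assumes "(\<lambda>x. (cmod (f x))\<^sup>2) summable_on A" and "(\<lambda>x. (cmod (g x))\<^sup>2) summable_on A"
  shows "(\<lambda>x. (cmod (f x + g x))\<^sup>2) summable_on A"
proof (rule summable_on_comparison_test)
  show "(\<lambda>x. 2 * (cmod (f x))\<^sup>2 + 2 * (cmod (g x))\<^sup>2) summable_on A"
    using assms by (intro summable_on_add summable_on_cmult_right)
  show "(cmod (f x + g x))\<^sup>2 \<le> 2 * (cmod (f x))\<^sup>2 + 2 * (cmod (g x))\<^sup>2" for x
  proof -
    have "(cmod (f x + g x))\<^sup>2 \<le> (cmod (f x) + cmod (g x))\<^sup>2"
      by (intro power_mono norm_triangle_ineq) auto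
    also have "\<dots> \<le> 2 * (cmod (f x))\<^sup>2 + 2 * (cmod (g x))\<^sup>2"
      using sum_squares_bound[of "cmod (f x)" "cmod (g x)"] by (simp add: power2_sum)
    finally show ?thesis .
  qed
qed simp

lemma square_summable_cmult:
  fixes f :: "'a \<Rightarrow> complex"
  assumes "(\<lambda>x. (cmod (f x))\<^sup>2) summable_on A"
  shows "(\<lambda>x. (cmod (c * f x))\<^sup>2) summable_on A"
  using summable_on_cmult_right[OF assms, of "(cmod c)\<^sup>2"] by (simp add: norm_mult power_mult_distrib)

lemma inner_square_summable:
  fixes f g :: "'a \<Rightarrow> complex"
  assumes "(\<lambda>x. (cmod (f x))\<^sup>2) summable_on A" and "(\<lambda>x. (cmod (g x))\<^sup>2) summable_on A"
  shows "(\<lambda>x. cmod (f x) * cmod (g x)) summable_on A"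
  using abs_summable_product[of "\<lambda>x. cmod (f x)" A "\<lambda>x. cmod (g x)"] assms
  by (simp add: power2_eq_square)

lemma inner_summable:
  fixes f g :: "'a \<Rightarrow> complex"
  assumes "(\<lambda>x. (cmod (f x))\<^sup>2) summable_on A" and "(\<lambda>x. (cmod (g x))\<^sup>2) summable_on A"
  shows "(\<lambda>x. f x \<bullet> g x) summable_on A"
  by (rule abs_summable_summable,
      rule Infinite_Sum.abs_summable_on_comparison_test'[OF inner_square_summable[OF assms]])
    (simp add: Cauchy_Schwarz_ineq2)

instantiation l2 :: (type) real_vector
begin

lift_definition zero_l2 :: "'a l2" is "\<lambda>_. 0" by simp
lift_definition plus_l2 :: "'a l2 \<Rightarrow> 'a l2 \<Rightarrow> 'a l2" is "\<lambda>f g x. f x + g x"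
  by (rule square_summable_add)
lift_definition uminus_l2 :: "'a l2 \<Rightarrow> 'a l2" is "\<lambda>f x. - f x" by simp
lift_definition minus_l2 :: "'a l2 \<Rightarrow> 'a l2 \<Rightarrow> 'a l2" is "\<lambda>f g x. f x - g x"
  using square_summable_add[where g = "\<lambda>x. - g x" for g] by simp
lift_definition scaleR_l2 :: "real \<Rightarrow> 'a l2 \<Rightarrow> 'a l2" is "\<lambda>r f x. r *\<^sub>R f x"
  by (simp add: scaleR_conv_of_real square_summable_cmult)

instance
proof
  fix f g h :: "'a l2" and r s :: real
  show "f + g + h = f + (g + h)" "f + g = g + f" "0 + f = f" "- f + f = 0" "f - g = f + - g"
    "r *\<^sub>R (f + g) = r *\<^sub>R f + r *\<^sub>R g" "(r + s) *\<^sub>R f = r *\<^sub>R f + s *\<^sub>R f"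
    "r *\<^sub>R s *\<^sub>R f = (r * s) *\<^sub>R f" "1 *\<^sub>R f = f"
    by (transfer; simp add: algebra_simps)+
qed

end

text \<open>On \<open>complex\<close>, \<open>x \<bullet> y\<close> is the real part of
  \<open>x * cnj y\<close>, so this is the real part of the Hermitian inner product. It induces the
  same norm; the complex structure returns with \<open>cscale\<close>.\<close>

instantiation l2 :: (type) real_inner
begin

definition inner_l2 :: "'a l2 \<Rightarrow> 'a l2 \<Rightarrow> real" where
  "inner_l2 f g = (\<Sum>\<^sub>\<infinity>x. coord f x \<bullet> coord g x)"
definition norm_l2 :: "'a l2 \<Rightarrow> real" where "norm_l2 f = sqrt (inner f f)"
definition sgn_l2 :: "'a l2 \<Rightarrow> 'a l2" where "sgn_l2 f = f /\<^sub>R norm f"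
definition dist_l2 :: "'a l2 \<Rightarrow> 'a l2 \<Rightarrow> real" where "dist_l2 f g = norm (f - g)"
definition uniformity_l2 :: "('a l2 \<times> 'a l2) filter" where
  "uniformity_l2 = (INF e\<in>{0 <..}. principal {(x, y). dist x y < e})"
definition open_l2 :: "'a l2 set \<Rightarrow> bool" where
  "open_l2 U = (\<forall>x\<in>U. eventually (\<lambda>(x', y). x' = x \<longrightarrow> y \<in> U) uniformity)"

instance
proof
  fix f g h :: "'a l2" and r :: real
  have summ: "(\<lambda>x. coord f x \<bullet> coord g x) summable_on UNIV" for f g :: "'a l2"
    by (intro inner_summable coord_square_summable)
  show "inner f g = inner g f"
    by (simp add: inner_l2_def inner_commute)
  show "inner (f + g) h = inner f h + inner g h"
    using infsum_add[OF summ[of f h] summ[of g h]]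
    by (simp add: inner_l2_def plus_l2.rep_eq inner_add_left)
  show "inner (r *\<^sub>R f) g = r * inner f g"
    by (simp add: inner_l2_def scaleR_l2.rep_eq infsum_cmult_right')
  show "0 \<le> inner f f"
    by (simp add: inner_l2_def infsum_nonneg)
  show "inner f f = 0 \<longleftrightarrow> f = 0"
  proof
    assume "inner f f = 0"
    then have "coord f x \<bullet> coord f x = 0" for x
      by (intro nonneg_infsum_le_0D[OF _ summ]) (auto simp: inner_l2_def)
    then have "coord f x = coord 0 x" for x by (simp add: zero_l2.rep_eq)
    then show "f = 0" by (auto simp flip: coord_inject)
  qed (simp add: inner_l2_def zero_l2.rep_eq)
qed (simp_all add: norm_l2_def sgn_l2_def dist_l2_def uniformity_l2_def open_l2_def)

end

lemma norm_l2_power2: "(norm f)\<^sup>2 = (\<Sum>\<^sub>\<infinity>x. (cmod (coord f x))\<^sup>2)"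
  by (simp add: power2_norm_eq_inner inner_l2_def flip: dot_square_norm)

lemma norm_l2_le:
  assumes "0 \<le> r" and "\<And>F. finite F \<Longrightarrow> (\<Sum>x\<in>F. (cmod (coord f x))\<^sup>2) \<le> r\<^sup>2"
  shows "norm f \<le> r"
proof (rule power2_le_imp_le)
  show "(norm f)\<^sup>2 \<le> r\<^sup>2"
    unfolding norm_l2_power2 using assms(2) by (intro infsum_le_finite_sums coord_square_summable)
qed (rule assms)

lemma sum_coord_le_norm_l2:
  assumes "finite F"
  shows "(\<Sum>x\<in>F. (cmod (coord f x))\<^sup>2) \<le> (norm f)\<^sup>2"
  unfolding norm_l2_power2 using assms by (intro finite_sum_le_infsum coord_square_summable) auto

lemma cmod_coord_le_norm_l2: "cmod (coord f x) \<le> norm f"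
  by (rule power2_le_imp_le) (use sum_coord_le_norm_l2[of "{x}" f] in auto)

text \<open>Each coordinate is dominated by the norm, so coordinates converge. Finite partial sums
  of the squared distance pass to this limit, and a bound uniform over all finite sets controls the
  full sum.\<close>

instance l2 :: (type) complete_space
proof
  fix X :: "nat \<Rightarrow> 'a l2"
  assume X: "Cauchy X"
  have "Cauchy (\<lambda>n. coord (X n) x)" for x
  proof (rule metric_CauchyI)
    fix e :: real assume "0 < e"
    then obtain N where "\<And>m n. m \<ge> N \<Longrightarrow> n \<ge> N \<Longrightarrow> dist (X m) (X n) < e"
      using metric_CauchyD[OF X] by metis
    moreover have "dist (coord f x) (coord g x) \<le> dist f g" for f g :: "'a l2"
      using cmod_coord_le_norm_l2[of "f - g" x] by (simp add: dist_norm minus_l2.rep_eq)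
    ultimately show "\<exists>N. \<forall>m\<ge>N. \<forall>n\<ge>N. dist (coord (X m) x) (coord (X n) x) < e"
      by (meson le_less_trans)
  qed
  then obtain g where g: "\<And>x. (\<lambda>n. coord (X n) x) \<longlonglongrightarrow> g x"
    unfolding Cauchy_convergent_iff convergent_def by metis
  have tail: "\<exists>N. \<forall>m\<ge>N. \<forall>F. finite F \<longrightarrow> (\<Sum>x\<in>F. (cmod (coord (X m) x - g x))\<^sup>2) \<le> e\<^sup>2"
    if e: "e > 0" for e
  proof -
    obtain N where N: "\<And>m n. m \<ge> N \<Longrightarrow> n \<ge> N \<Longrightarrow> dist (X m) (X n) < e"
      using metric_CauchyD[OF X e] by metis
    have "(\<Sum>x\<in>F. (cmod (coord (X m) x - g x))\<^sup>2) \<le> e\<^sup>2" if "m \<ge> N" "finite F" for m F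
    proof (rule tendsto_upperbound)
      show "(\<lambda>n. \<Sum>x\<in>F. (cmod (coord (X m) x - coord (X n) x))\<^sup>2)
        \<longlonglongrightarrow> (\<Sum>x\<in>F. (cmod (coord (X m) x - g x))\<^sup>2)"
        by (intro tendsto_intros g)
      have "(\<Sum>x\<in>F. (cmod (coord (X m) x - coord (X n) x))\<^sup>2) \<le> e\<^sup>2" if "n \<ge> N" for n
      proof -
        have "(\<Sum>x\<in>F. (cmod (coord (X m) x - coord (X n) x))\<^sup>2) \<le> (norm (X m - X n))\<^sup>2"
          using sum_coord_le_norm_l2[OF \<open>finite F\<close>, of "X m - X n"] by (simp add: minus_l2.rep_eq)
        also have "\<dots> \<le> e\<^sup>2"
          using N[OF \<open>m \<ge> N\<close> that] by (intro power_mono) (auto simp: dist_norm)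
        finally show ?thesis .
      qed
      then show "\<forall>\<^sub>F n in sequentially. (\<Sum>x\<in>F. (cmod (coord (X m) x - coord (X n) x))\<^sup>2) \<le> e\<^sup>2"
        by (auto simp: eventually_sequentially)
    qed simp
    then show ?thesis by blast
  qed
  obtain N where "\<And>F. finite F \<Longrightarrow> (\<Sum>x\<in>F. (cmod (coord (X N) x - g x))\<^sup>2) \<le> 1\<^sup>2"
    using tail[of 1] by auto
  then have "(\<lambda>x. (cmod (coord (X N) x - g x))\<^sup>2) summable_on UNIV"
    by (intro nonneg_bdd_above_summable_on bdd_aboveI2[of _ _ "1\<^sup>2"]) auto
  \<comment> \<open>The limit is written as an element of the space minus a square-summable
    error.\<close>
  then have "(\<lambda>x. (cmod (coord (X N) x + - (coord (X N) x - g x)))\<^sup>2) summable_on UNIV"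
    by (intro square_summable_add coord_square_summable) (simp add: norm_minus_commute)
  then have "(\<lambda>x. (cmod (g x))\<^sup>2) summable_on UNIV" by simp
  then obtain G where G: "coord G = g"
    using Abs_l2_inverse[of g] by auto
  have "X \<longlonglongrightarrow> G"
  proof (rule metric_LIMSEQ_I)
    fix e :: real assume "0 < e"
    then obtain N where N: "\<And>m F. m \<ge> N \<Longrightarrow> finite F \<Longrightarrow> (\<Sum>x\<in>F. (cmod (coord (X m) x - g x))\<^sup>2) \<le> (e/2)\<^sup>2"
      using tail[of "e/2"] by auto
    have "dist (X m) G < e" if "m \<ge> N" for m
      using norm_l2_le[of "e/2" "X m - G"] N[OF that] \<open>0 < e\<close>
      by (simp add: dist_norm minus_l2.rep_eq G)
    then show "\<exists>N. \<forall>m\<ge>N. dist (X m) G < e" by blast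
  qed
  then show "convergent X" by (rule convergentI)
qed

text \<open>Both \<open>S\<close> and its adjoint are bounded below, so \<open>S \<circ> S'\<close> is bounded and coercive, and
  the equation \<open>S (S' x) = y\<close> is solved by the contraction \<open>x \<mapsto> x + t (y - S (S' x))\<close>.\<close>

lemma surj_if_bounded_below_adjoint:
  fixes S S' :: "'a :: {real_inner, complete_space} \<Rightarrow> 'a"
  assumes S: "bounded_linear S" and S': "bounded_linear S'"
    and adj: "\<And>x y. S x \<bullet> y = x \<bullet> S' y"
    and c: "0 < c" and below: "\<And>x. c * norm x \<le> norm (S' x)"
  shows "surj S"
proof -
  interpret A: bounded_linear "\<lambda>x. S (S' x)"
    using bounded_linear_compose[OF S S'] .
  obtain M where M: "M > 0" "\<And>x. norm (S (S' x)) \<le> norm x * M"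
    using A.pos_bounded by blast
  have coercive: "c\<^sup>2 * (norm d)\<^sup>2 \<le> S (S' d) \<bullet> d" for d
  proof -
    have "(c * norm d)\<^sup>2 \<le> (norm (S' d))\<^sup>2" using below c by (intro power_mono) auto
    also have "\<dots> = S (S' d) \<bullet> d" by (simp add: adj dot_square_norm)
    finally show ?thesis by (simp add: power_mult_distrib)
  qed
  \<comment> \<open>The bound \<open>c\<^sup>2 / M\<^sup>2\<close> lets half of the linear term
    absorb the quadratic term in the expansion of the squared norm below, leaving the factor
    \<open>1 - t * c\<^sup>2\<close>. The bound \<open>1 / c\<^sup>2\<close> keeps that factor
    nonnegative, so that \<open>q\<close> is its genuine root.\<close>
  define t where "t = min (c\<^sup>2 / M\<^sup>2) (1 / c\<^sup>2)"
  define q where "q = sqrt (1 - t * c\<^sup>2)"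
  have t: "0 < t" "t * M\<^sup>2 \<le> c\<^sup>2" "t * c\<^sup>2 \<le> 1"
    using c M(1) by (auto simp: t_def min_def field_simps)
  have q: "0 \<le> q" "q < 1" using t c by (auto simp: q_def)
  have contr: "norm (d - t *\<^sub>R S (S' d)) \<le> q * norm d" for d
  proof (rule power2_le_imp_le)
    have "(norm (d - t *\<^sub>R S (S' d)))\<^sup>2 = (norm d)\<^sup>2 - 2 * t * (S (S' d) \<bullet> d) + t\<^sup>2 * (norm (S (S' d)))\<^sup>2"
      unfolding power2_norm_eq_inner
      by (simp add: inner_diff_left inner_diff_right inner_commute[of d "S (S' d)"] power2_eq_square[of t] algebra_simps)
    also have "\<dots> \<le> (norm d)\<^sup>2 - 2 * t * (c\<^sup>2 * (norm d)\<^sup>2) + t * (c\<^sup>2 * (norm d)\<^sup>2)"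
    proof -
      have "t\<^sup>2 * (norm (S (S' d)))\<^sup>2 \<le> t\<^sup>2 * (norm d * M)\<^sup>2"
        using M by (intro mult_left_mono power_mono) auto
      also have "\<dots> = t * ((t * M\<^sup>2) * (norm d)\<^sup>2)" by (simp add: power2_eq_square)
      also have "\<dots> \<le> t * (c\<^sup>2 * (norm d)\<^sup>2)"
        using t by (intro mult_left_mono mult_right_mono) auto
      finally have "t\<^sup>2 * (norm (S (S' d)))\<^sup>2 \<le> t * (c\<^sup>2 * (norm d)\<^sup>2)" .
      moreover have "t * (c\<^sup>2 * (norm d)\<^sup>2) \<le> t * (S (S' d) \<bullet> d)"
        using t coercive by (intro mult_left_mono) auto
      ultimately show ?thesis by linarith
    qed
    also have "\<dots> = (q * norm d)\<^sup>2"
      using t by (simp add: q_def power_mult_distrib algebra_simps)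
    finally show "(norm (d - t *\<^sub>R S (S' d)))\<^sup>2 \<le> (q * norm d)\<^sup>2" .
  qed (use q in simp)
  show ?thesis
  proof (rule surjI)
    fix y
    have "\<exists>!x. x + t *\<^sub>R (y - S (S' x)) = x"
    proof (rule banach_fix_type[OF q])
      show "\<forall>x x'. dist (x + t *\<^sub>R (y - S (S' x))) (x' + t *\<^sub>R (y - S (S' x'))) \<le> q * dist x x'"
      proof (intro allI)
        fix x x'
        have "x + t *\<^sub>R (y - S (S' x)) - (x' + t *\<^sub>R (y - S (S' x'))) = (x - x') - t *\<^sub>R S (S' (x - x'))"
          by (simp add: A.diff scaleR_diff_right)
        then show "dist (x + t *\<^sub>R (y - S (S' x))) (x' + t *\<^sub>R (y - S (S' x'))) \<le> q * dist x x'"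
          unfolding dist_norm using contr[of "x - x'"] by (simp only:)
      qed
    qed
    then obtain x where "x + t *\<^sub>R (y - S (S' x)) = x" by metis
    then have "S (S' x) = y" using t(1) by simp
    then have "\<exists>x. S (S' x) = y" ..
    then show "S (S' (SOME x. S (S' x) = y)) = y" by (rule someI_ex)
  qed
qed

section \<open>Schur-bounded kernels\<close>

text \<open>An absolutely convergent unordered sum is an integral for the counting measure, so
  Lebesgue's theorem applies.\<close>

lemma infsum_dominated_convergence:
  fixes a :: "nat \<Rightarrow> 'a \<Rightarrow> 'b :: {banach, second_countable_topology}"
  assumes lim: "\<And>x. (\<lambda>n. a n x) \<longlonglongrightarrow> b x"
    and bound: "\<And>n x. norm (a n x) \<le> g x" and g: "g summable_on UNIV"
  shows "(\<lambda>n. \<Sum>\<^sub>\<infinity>x. a n x) \<longlonglongrightarrow> (\<Sum>\<^sub>\<infinity>x. b x)"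
proof -
  have b: "norm (b x) \<le> g x" for x
    using bound by (intro tendsto_upperbound[OF tendsto_norm[OF lim]]) auto
  have integrable: "integrable (count_space UNIV) f" and infsum_eq: "infsum f UNIV = (LINT x|count_space UNIV. f x)"
    if "\<And>x. norm (f x) \<le> g x" for f :: "'a \<Rightarrow> 'b"
  proof -
    have "Infinite_Sum.abs_summable_on f UNIV"
      by (rule Infinite_Sum.abs_summable_on_comparison_test'[OF g that])
    then have "Infinite_Set_Sum.abs_summable_on f UNIV"
      by (simp only: abs_summable_equivalent)
    then show "integrable (count_space UNIV) f" "infsum f UNIV = (LINT x|count_space UNIV. f x)"
      by (simp_all add: abs_summable_on_def infsetsum_infsum[symmetric] infsetsum_def)
  qed
  have "integrable (count_space UNIV) g"
  proof -
    have "Infinite_Set_Sum.abs_summable_on g UNIV"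
      using g unfolding abs_summable_equivalent[symmetric]
      by (rule summable_on_iff_abs_summable_on_real[THEN iffD1])
    then show ?thesis by (simp add: abs_summable_on_def)
  qed
  then have "(\<lambda>n. LINT x|count_space UNIV. a n x) \<longlonglongrightarrow> (LINT x|count_space UNIV. b x)"
    using lim bound by (intro integral_dominated_convergence[where w = g]) auto
  then show ?thesis
    by (simp add: infsum_eq[OF b] infsum_eq[OF bound])
qed

text \<open>The hypothesis of the Schur test with unit weights. Unlike an operator norm bound it
  sees only moduli of entries, so it passes to every kernel dominated entrywise; limits are
  controlled in this way.\<close>

definition schur_bounded :: "real \<Rightarrow> ('a \<Rightarrow> 'b \<Rightarrow> 'c::real_normed_vector) \<Rightarrow> bool" where
  "schur_bounded M k \<longleftrightarrow>
     (\<forall>x. (\<lambda>y. norm (k x y)) summable_on UNIV \<and> (\<Sum>\<^sub>\<infinity>y. norm (k x y)) \<le> M) \<and>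
     (\<forall>y. (\<lambda>x. norm (k x y)) summable_on UNIV \<and> (\<Sum>\<^sub>\<infinity>x. norm (k x y)) \<le> M)"

lemma schur_bounded_transpose: "schur_bounded M k \<Longrightarrow> schur_bounded M (\<lambda>y x. k x y)"
  by (auto simp: schur_bounded_def)

lemma summable_infsum_le_mono:
  fixes f g :: "'a \<Rightarrow> real"
  assumes "g summable_on A" "infsum g A \<le> M" "\<And>x. 0 \<le> f x" "\<And>x. f x \<le> g x"
  shows "f summable_on A \<and> infsum f A \<le> M"
proof -
  have "f summable_on A" using assms by (blast intro: summable_on_comparison_test)
  moreover have "infsum f A \<le> infsum g A" using calculation assms by (intro infsum_mono) auto
  ultimately show ?thesis using assms(2) by linarith
qed

lemma schur_bounded_mono:
  assumes "schur_bounded M d" "\<And>x y. norm (k x y) \<le> norm (d x y)"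
  shows "schur_bounded M k"
  unfolding schur_bounded_def
proof (intro conjI allI)
  show "(\<lambda>y. norm (k x y)) summable_on UNIV" "(\<Sum>\<^sub>\<infinity>y. norm (k x y)) \<le> M" for x
    using summable_infsum_le_mono[of "\<lambda>y. norm (d x y)" UNIV M "\<lambda>y. norm (k x y)"] assms
    by (auto simp: schur_bounded_def)
  show "(\<lambda>x. norm (k x y)) summable_on UNIV" "(\<Sum>\<^sub>\<infinity>x. norm (k x y)) \<le> M" for y
    using summable_infsum_le_mono[of "\<lambda>x. norm (d x y)" UNIV M "\<lambda>x. norm (k x y)"] assms
    by (auto simp: schur_bounded_def)
qed

lemma schur_bounded_nonneg: "schur_bounded M k \<Longrightarrow> 0 \<le> M"
  unfolding schur_bounded_def by (meson infsum_nonneg norm_ge_zero order_trans)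

lemma schur_bounded_weighted_summable:
  assumes k: "schur_bounded M k" and f: "f summable_on UNIV" "\<And>y. 0 \<le> f y"
  shows "(\<lambda>y. norm (k x y) * f y) summable_on UNIV"
proof (rule summable_on_comparison_test)
  show "(\<lambda>y. M * f y) summable_on UNIV" by (intro summable_on_cmult_right f)
  have "norm (k x y) \<le> M" for y
  proof -
    have "(\<Sum>y\<in>{y}. norm (k x y)) \<le> (\<Sum>\<^sub>\<infinity>y. norm (k x y))"
      using k by (intro finite_sum_le_infsum) (auto simp: schur_bounded_def)
    also have "\<dots> \<le> M" using k by (auto simp: schur_bounded_def)
    finally show ?thesis by simp
  qed
  then show "norm (k x y) * f y \<le> M * f y" for y
    using f by (intro mult_right_mono)
qed (use f in simp)

lemma schur_bounded_row_summable:
  fixes f :: "'b \<Rightarrow> complex"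
  assumes k: "schur_bounded M k" and f: "(\<lambda>y. (cmod (f y))\<^sup>2) summable_on UNIV"
  shows "(\<lambda>y. norm (k x y) * cmod (f y)) summable_on UNIV"
proof (rule summable_on_comparison_test)
  show "(\<lambda>y. norm (k x y) + norm (k x y) * (cmod (f y))\<^sup>2) summable_on UNIV"
    using k schur_bounded_weighted_summable[OF k f] by (intro summable_on_add) (auto simp: schur_bounded_def)
  \<comment> \<open>This trades the linear weight for the row itself plus a row weighted by squares,
    both already summable.\<close>
  have "t \<le> 1 + t\<^sup>2" for t :: real using zero_le_power2[of "t - 1 / 2"] by (simp add: power2_eq_square algebra_simps)
  from mult_left_mono[OF this norm_ge_zero]
  show "norm (k x y) * cmod (f y) \<le> norm (k x y) + norm (k x y) * (cmod (f y))\<^sup>2" for y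
    by (simp add: algebra_simps)
qed simp

text \<open>Cauchy-Schwarz with respect to the weights \<open>norm (k x y)\<close>, of total mass at
  most \<open>M\<close>; each weight is split into two square roots.\<close>

lemma schur_bounded_Cauchy_Schwarz:
  fixes f :: "'b \<Rightarrow> complex"
  assumes k: "schur_bounded M k" and f: "(\<lambda>y. (cmod (f y))\<^sup>2) summable_on UNIV"
  shows "(\<Sum>\<^sub>\<infinity>y. norm (k x y) * cmod (f y))\<^sup>2 \<le> M * (\<Sum>\<^sub>\<infinity>y. norm (k x y) * (cmod (f y))\<^sup>2)"
proof -
  have M: "0 \<le> M" by (rule schur_bounded_nonneg[OF k])
  let ?w = "\<Sum>\<^sub>\<infinity>y. norm (k x y) * (cmod (f y))\<^sup>2"
  have "(\<Sum>\<^sub>\<infinity>y. norm (k x y) * cmod (f y)) \<le> sqrt (M * ?w)"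
  proof (rule infsum_le_finite_sums[OF schur_bounded_row_summable[OF k f]])
    fix F :: "'b set" assume F: "finite F"
    have "(\<Sum>y\<in>F. norm (k x y) * cmod (f y))\<^sup>2 =
        (\<Sum>y\<in>F. sqrt (norm (k x y)) * (sqrt (norm (k x y)) * cmod (f y)))\<^sup>2"
      by (simp flip: mult.assoc)
    also have "\<dots> \<le> (\<Sum>y\<in>F. (sqrt (norm (k x y)))\<^sup>2) * (\<Sum>y\<in>F. (sqrt (norm (k x y)) * cmod (f y))\<^sup>2)"
      by (rule Cauchy_Schwarz_ineq_sum)
    also have "\<dots> = (\<Sum>y\<in>F. norm (k x y)) * (\<Sum>y\<in>F. norm (k x y) * (cmod (f y))\<^sup>2)"
      by (simp add: power_mult_distrib)
    also have "\<dots> \<le> M * ?w"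
    proof (rule mult_mono)
      have "(\<Sum>y\<in>F. norm (k x y)) \<le> (\<Sum>\<^sub>\<infinity>y. norm (k x y))"
        using k F by (intro finite_sum_le_infsum) (auto simp: schur_bounded_def)
      also have "\<dots> \<le> M" using k by (auto simp: schur_bounded_def)
      finally show "(\<Sum>y\<in>F. norm (k x y)) \<le> M" .
      show "(\<Sum>y\<in>F. norm (k x y) * (cmod (f y))\<^sup>2) \<le> ?w"
        using F by (intro finite_sum_le_infsum schur_bounded_weighted_summable[OF k f]) auto
    qed (auto intro: sum_nonneg M)
    finally show "(\<Sum>y\<in>F. norm (k x y) * cmod (f y)) \<le> sqrt (M * ?w)"
      by (rule real_le_rsqrt)
  qed
  then have "(\<Sum>\<^sub>\<infinity>y. norm (k x y) * cmod (f y))\<^sup>2 \<le> (sqrt (M * ?w))\<^sup>2"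
    by (intro power_mono infsum_nonneg) auto
  then show ?thesis using M by (simp add: infsum_nonneg)
qed

lemma has_sum_finite_sum:
  fixes f :: "'a \<Rightarrow> 'b \<Rightarrow> 'c::topological_comm_monoid_add"
  assumes "finite F" "\<And>x. (f x has_sum s x) A"
  shows "((\<lambda>y. \<Sum>x\<in>F. f x y) has_sum (\<Sum>x\<in>F. s x)) A"
  using assms(1) by induction (auto intro: has_sum_add assms(2))

text \<open>The rows give one factor \<open>M\<close> through the weighted Cauchy-Schwarz
  inequality, the columns give the other after the sums are exchanged. For finite \<open>F\<close>
  this exchange is plain additivity.\<close>

lemma schur_test:
  fixes f :: "'b \<Rightarrow> complex"
  assumes k: "schur_bounded M k" and f: "(\<lambda>y. (cmod (f y))\<^sup>2) summable_on UNIV" and F: "finite F"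
  shows "(\<Sum>x\<in>F. (\<Sum>\<^sub>\<infinity>y. norm (k x y) * cmod (f y))\<^sup>2) \<le> M\<^sup>2 * (\<Sum>\<^sub>\<infinity>y. (cmod (f y))\<^sup>2)"
proof -
  have M: "0 \<le> M" by (rule schur_bounded_nonneg[OF k])
  note w = schur_bounded_weighted_summable[OF k f zero_le_power2]
  have "(\<Sum>x\<in>F. (\<Sum>\<^sub>\<infinity>y. norm (k x y) * cmod (f y))\<^sup>2)
      \<le> (\<Sum>x\<in>F. M * (\<Sum>\<^sub>\<infinity>y. norm (k x y) * (cmod (f y))\<^sup>2))"
    by (intro sum_mono schur_bounded_Cauchy_Schwarz[OF k f])
  also have "\<dots> = M * (\<Sum>\<^sub>\<infinity>y. \<Sum>x\<in>F. norm (k x y) * (cmod (f y))\<^sup>2)"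
    using infsumI[OF has_sum_finite_sum[OF F has_sum_infsum[OF w]]]
    by (simp add: sum_distrib_left)
  also have "\<dots> \<le> M * (\<Sum>\<^sub>\<infinity>y. M * (cmod (f y))\<^sup>2)"
  proof (intro mult_left_mono M infsum_mono)
    show "(\<lambda>y. \<Sum>x\<in>F. norm (k x y) * (cmod (f y))\<^sup>2) summable_on UNIV"
      using has_sum_finite_sum[OF F has_sum_infsum[OF w]] by (rule has_sum_imp_summable)
    show "(\<lambda>y. M * (cmod (f y))\<^sup>2) summable_on UNIV"
      by (intro summable_on_cmult_right f)
    fix y
    have "(\<Sum>x\<in>F. norm (k x y)) \<le> (\<Sum>\<^sub>\<infinity>x. norm (k x y))"
      using k F by (intro finite_sum_le_infsum) (auto simp: schur_bounded_def)
    also have "\<dots> \<le> M" using k by (auto simp: schur_bounded_def)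
    finally show "(\<Sum>x\<in>F. norm (k x y) * (cmod (f y))\<^sup>2) \<le> M * (cmod (f y))\<^sup>2"
      by (auto simp flip: sum_distrib_right intro: mult_right_mono)
  qed
  also have "\<dots> = M\<^sup>2 * (\<Sum>\<^sub>\<infinity>y. (cmod (f y))\<^sup>2)"
    by (simp add: infsum_cmult_right' power2_eq_square)
  finally show ?thesis .
qed

lemma schur_square_summable:
  fixes f :: "'b \<Rightarrow> complex"
  assumes k: "schur_bounded M k" and f: "(\<lambda>y. (cmod (f y))\<^sup>2) summable_on UNIV"
  shows "(\<lambda>x. (\<Sum>\<^sub>\<infinity>y. norm (k x y) * cmod (f y))\<^sup>2) summable_on UNIV"
  using schur_test[OF k f] by (intro nonneg_bdd_above_summable_on bdd_aboveI2) auto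

definition kernel_op :: "('a \<Rightarrow> 'b \<Rightarrow> complex) \<Rightarrow> ('b \<Rightarrow> complex) \<Rightarrow> 'a \<Rightarrow> complex" where
  "kernel_op k f x = (\<Sum>\<^sub>\<infinity>y. k x y * f y)"

lemma kernel_op_row_abs_summable:
  fixes f :: "'b \<Rightarrow> complex" and k :: "'a \<Rightarrow> 'b \<Rightarrow> complex"
  assumes k: "schur_bounded M k" and f: "(\<lambda>y. (cmod (f y))\<^sup>2) summable_on UNIV"
  shows "(\<lambda>y. cmod (k x y * f y)) summable_on UNIV"
  using schur_bounded_row_summable[OF k f] by (simp add: norm_mult)

lemma kernel_op_row_summable:
  fixes f :: "'b \<Rightarrow> complex" and k :: "'a \<Rightarrow> 'b \<Rightarrow> complex"
  assumes k: "schur_bounded M k" and f: "(\<lambda>y. (cmod (f y))\<^sup>2) summable_on UNIV"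
  shows "(\<lambda>y. k x y * f y) summable_on UNIV"
  by (rule abs_summable_summable[OF kernel_op_row_abs_summable[OF k f]])

lemma cmod_kernel_op_le:
  fixes f :: "'b \<Rightarrow> complex" and k :: "'a \<Rightarrow> 'b \<Rightarrow> complex"
  assumes k: "schur_bounded M k" and f: "(\<lambda>y. (cmod (f y))\<^sup>2) summable_on UNIV"
  shows "cmod (kernel_op k f x) \<le> (\<Sum>\<^sub>\<infinity>y. cmod (k x y) * cmod (f y))"
  using norm_infsum_bound[of "\<lambda>y. k x y * f y" UNIV] kernel_op_row_abs_summable[OF k f]
  by (simp add: kernel_op_def norm_mult)

lemma kernel_op_square_summable:
  fixes f :: "'b \<Rightarrow> complex" and k :: "'a \<Rightarrow> 'b \<Rightarrow> complex"
  assumes k: "schur_bounded M k" and f: "(\<lambda>y. (cmod (f y))\<^sup>2) summable_on UNIV"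
  shows "(\<lambda>x. (cmod (kernel_op k f x))\<^sup>2) summable_on UNIV"
  using cmod_kernel_op_le[OF k f]
  by (intro summable_on_comparison_test[OF schur_square_summable[OF k f]] power_mono) auto

definition kernel_l2 :: "('a \<Rightarrow> 'b \<Rightarrow> complex) \<Rightarrow> 'b l2 \<Rightarrow> 'a l2" where
  "kernel_l2 k f = Abs_l2 (kernel_op k (coord f))"

lemma coord_kernel_l2:
  assumes "schur_bounded M k"
  shows "coord (kernel_l2 k f) = kernel_op k (coord f)"
  unfolding kernel_l2_def
  using kernel_op_square_summable[OF assms coord_square_summable] by (subst Abs_l2_inverse) auto

lemma bounded_linear_kernel_l2:
  assumes k: "schur_bounded M k"
  shows "bounded_linear (kernel_l2 k)"
proof (rule bounded_linear_intro)
  note summ = kernel_op_row_summable[OF k coord_square_summable]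
  show "kernel_l2 k (f + g) = kernel_l2 k f + kernel_l2 k g" for f g
    by (simp add: coord_inject[symmetric] fun_eq_iff coord_kernel_l2[OF k] plus_l2.rep_eq
        kernel_op_def distrib_left infsum_add summ)
  show "kernel_l2 k (r *\<^sub>R f) = r *\<^sub>R kernel_l2 k f" for r f
    by (simp add: coord_inject[symmetric] fun_eq_iff coord_kernel_l2[OF k] scaleR_l2.rep_eq
        kernel_op_def infsum_scaleR_right)
  show "norm (kernel_l2 k f) \<le> norm f * M" for f
  proof (rule norm_l2_le)
    show "0 \<le> norm f * M" using schur_bounded_nonneg[OF k] by simp
    fix F :: "'a set" assume F: "finite F"
    have "(\<Sum>x\<in>F. (cmod (coord (kernel_l2 k f) x))\<^sup>2)
        \<le> (\<Sum>x\<in>F. (\<Sum>\<^sub>\<infinity>y. norm (k x y) * cmod (coord f y))\<^sup>2)"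
      by (intro sum_mono power_mono) (auto simp: coord_kernel_l2[OF k] cmod_kernel_op_le[OF k coord_square_summable])
    also have "\<dots> \<le> (norm f * M)\<^sup>2"
      using schur_test[OF k coord_square_summable F]
      by (simp add: norm_l2_power2 power_mult_distrib mult.commute)
    finally show "(\<Sum>x\<in>F. (cmod (coord (kernel_l2 k f) x))\<^sup>2) \<le> (norm f * M)\<^sup>2" .
  qed
qed

lemma inner_complex_eq_Re: "x \<bullet> y = Re (x * cnj y)" for x y :: complex
  by (simp add: inner_complex_def)

text \<open>Both sides are iterated sums of the same double family \<open>p\<close>, taken in
  opposite orders.\<close>

lemma inner_kernel_l2_adjoint:
  assumes k: "schur_bounded M k"
  shows "kernel_l2 k f \<bullet> g = f \<bullet> kernel_l2 (\<lambda>y x. cnj (k x y)) g"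
proof -
  have k': "schur_bounded M (\<lambda>y x. cnj (k x y))"
    by (rule schur_bounded_mono[OF schur_bounded_transpose[OF k]]) simp
  note f = coord_square_summable[of f] and g = coord_square_summable[of g]
  define p where "p x y = (k x y * coord f y) \<bullet> coord g x" for x y
  have p_le: "\<bar>p x y\<bar> \<le> cmod (k x y) * cmod (coord f y) * cmod (coord g x)" for x y
    using Cauchy_Schwarz_ineq2[of "k x y * coord f y" "coord g x"] by (simp add: p_def norm_mult)
  \<comment> \<open>Absolute summability for Fubini: by the Schur test the row sums against
    \<open>coord f\<close> are square-summable, so they can be paired with
    \<open>coord g\<close>.\<close>
  have "(\<lambda>xy. cmod (k (fst xy) (snd xy)) * cmod (coord f (snd xy)) * cmod (coord g (fst xy)))
      summable_on UNIV \<times> UNIV"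
  proof (rule summable_on_SigmaI)
    show "((\<lambda>y. cmod (k (fst (x, y)) (snd (x, y))) * cmod (coord f (snd (x, y))) * cmod (coord g (fst (x, y))))
        has_sum (\<Sum>\<^sub>\<infinity>y. cmod (k x y) * cmod (coord f y)) * cmod (coord g x)) UNIV" for x
      using has_sum_cmult_left[OF has_sum_infsum[OF schur_bounded_row_summable[OF k f]]] by simp
    show "(\<lambda>x. (\<Sum>\<^sub>\<infinity>y. cmod (k x y) * cmod (coord f y)) * cmod (coord g x)) summable_on UNIV"
      using inner_square_summable[of "\<lambda>x. complex_of_real (\<Sum>\<^sub>\<infinity>y. cmod (k x y) * cmod (coord f y))", OF _ g]
        schur_square_summable[OF k f] by (simp add: abs_of_nonneg infsum_nonneg)
  qed auto
  then have "(\<lambda>(x, y). cmod (k x y) * cmod (coord f y) * cmod (coord g x)) summable_on UNIV \<times> UNIV"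
    unfolding UNIV_Times_UNIV case_prod_unfold .
  then have "(\<lambda>(x, y). p x y) summable_on UNIV \<times> UNIV"
    by (rule abs_summable_summable[OF Infinite_Sum.abs_summable_on_comparison_test'])
      (use p_le in auto)
  then have "(\<Sum>\<^sub>\<infinity>x. \<Sum>\<^sub>\<infinity>y. p x y) = (\<Sum>\<^sub>\<infinity>y. \<Sum>\<^sub>\<infinity>x. p x y)"
    by (rule infsum_swap_banach)
  moreover have "(\<Sum>\<^sub>\<infinity>y. p x y) = kernel_op k (coord f) x \<bullet> coord g x" for x
    unfolding p_def kernel_op_def
    by (rule infsumI has_sum_bounded_linear[OF bounded_linear_inner_left] has_sum_infsum
        kernel_op_row_summable[OF k f])+
  moreover have "(\<Sum>\<^sub>\<infinity>x. p x y) = coord f y \<bullet> kernel_op (\<lambda>y x. cnj (k x y)) (coord g) y" for y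
  proof -
    have "p x y = coord f y \<bullet> (cnj (k x y) * coord g x)" for x
      by (simp add: p_def inner_complex_eq_Re algebra_simps)
    then show ?thesis
      unfolding kernel_op_def
      by (simp only:) (rule infsumI has_sum_bounded_linear[OF bounded_linear_inner_right] has_sum_infsum
        kernel_op_row_summable[OF k' g])+
  qed
  ultimately show ?thesis
    by (simp add: inner_l2_def coord_kernel_l2[OF k] coord_kernel_l2[OF k'])
qed

text \<open>Dominated convergence is used twice: along each row, then over the rows. From entrywise
  convergence this yields strong convergence, not convergence in norm.\<close>

lemma kernel_l2_tendsto:
  fixes k :: "nat \<Rightarrow> 'a \<Rightarrow> 'b \<Rightarrow> complex"
  assumes lim: "\<And>x y. (\<lambda>n. k n x y) \<longlonglongrightarrow> k' x y"
    and bound: "\<And>n x y. norm (k n x y) \<le> norm (d x y)" and d: "schur_bounded M d"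
  shows "(\<lambda>n. kernel_l2 (k n) f) \<longlonglongrightarrow> kernel_l2 k' f"
proof -
  note f = coord_square_summable[of f]
  have bound': "norm (k' x y) \<le> norm (d x y)" for x y
    using bound by (intro tendsto_upperbound[OF tendsto_norm[OF lim]]) auto
  have k: "schur_bounded M (k n)" and k': "schur_bounded M k'" for n
    using schur_bounded_mono[OF d] bound bound' by blast+
  define g where "g x = (\<Sum>\<^sub>\<infinity>y. norm (d x y) * cmod (coord f y))" for x
  have kop: "(\<lambda>n. kernel_op (k n) (coord f) x) \<longlonglongrightarrow> kernel_op k' (coord f) x" for x
    unfolding kernel_op_def
    by (rule infsum_dominated_convergence[OF _ _ schur_bounded_row_summable[OF d f]])
      (auto intro!: tendsto_intros lim mult_right_mono bound simp: norm_mult)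
  have le_g: "cmod (kernel_op l (coord f) x) \<le> g x"
    if "\<And>y. norm (l x y) \<le> norm (d x y)" and l: "schur_bounded M l" for l x
  proof -
    have "cmod (kernel_op l (coord f) x) \<le> (\<Sum>\<^sub>\<infinity>y. cmod (l x y) * cmod (coord f y))"
      by (rule cmod_kernel_op_le[OF l f])
    also have "\<dots> \<le> g x"
      unfolding g_def using that
      by (intro infsum_mono schur_bounded_row_summable[OF l f] schur_bounded_row_summable[OF d f] mult_right_mono) auto
    finally show ?thesis .
  qed
  have "(\<lambda>n. \<Sum>\<^sub>\<infinity>x. (cmod (kernel_op (k n) (coord f) x - kernel_op k' (coord f) x))\<^sup>2) \<longlonglongrightarrow> (\<Sum>\<^sub>\<infinity>x::'a. 0)"
  \<comment> \<open>Both images are at most \<open>g x\<close> in modulus, so their difference is at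
    most \<open>2 * g x\<close>; squaring gives the \<open>4\<close>.\<close>
  proof (rule infsum_dominated_convergence[where g = "\<lambda>x. 4 * (g x)\<^sup>2"])
    show "(\<lambda>n. (cmod (kernel_op (k n) (coord f) x - kernel_op k' (coord f) x))\<^sup>2) \<longlonglongrightarrow> 0" for x
      using tendsto_power[OF tendsto_norm[OF tendsto_diff[OF kop[of x] tendsto_const[of "kernel_op k' (coord f) x"]]], of 2]
      by simp
    show "norm ((cmod (kernel_op (k n) (coord f) x - kernel_op k' (coord f) x))\<^sup>2) \<le> 4 * (g x)\<^sup>2" for n x
    proof -
      have "cmod (kernel_op (k n) (coord f) x - kernel_op k' (coord f) x) \<le> 2 * g x"
        using le_g[OF bound k, of n x] le_g[OF bound' k', of x]
          norm_triangle_ineq4[of "kernel_op (k n) (coord f) x" "kernel_op k' (coord f) x"] by linarith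
      then have "(cmod (kernel_op (k n) (coord f) x - kernel_op k' (coord f) x))\<^sup>2 \<le> (2 * g x)\<^sup>2"
        by (intro power_mono) auto
      then show ?thesis by (simp add: power_mult_distrib)
    qed
    show "(\<lambda>x. 4 * (g x)\<^sup>2) summable_on UNIV"
      unfolding g_def by (intro summable_on_cmult_right schur_square_summable[OF d f])
  qed
  then have "(\<lambda>n. (norm (kernel_l2 (k n) f - kernel_l2 k' f))\<^sup>2) \<longlonglongrightarrow> 0"
    by (simp add: norm_l2_power2 minus_l2.rep_eq coord_kernel_l2[OF k] coord_kernel_l2[OF k'])
  then have "(\<lambda>n. sqrt ((norm (kernel_l2 (k n) f - kernel_l2 k' f))\<^sup>2)) \<longlonglongrightarrow> sqrt 0"
    by (rule tendsto_real_sqrt)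
  then show ?thesis
    by (simp add: LIM_zero_iff tendsto_norm_zero_iff)
qed

section \<open>Complex scalars and Hermitian kernels\<close>

lift_definition cscale :: "complex \<Rightarrow> 'a l2 \<Rightarrow> 'a l2" is "\<lambda>z f x. z * f x"
  by (rule square_summable_cmult)

lemma kernel_l2_cscale:
  assumes k: "schur_bounded M k"
  shows "kernel_l2 k (cscale z f) = cscale z (kernel_l2 k f)"
  by (simp add: coord_inject[symmetric] fun_eq_iff coord_kernel_l2[OF k] cscale.rep_eq kernel_op_def
      mult.left_commute[of _ z] infsum_cmult_right')

lemma norm_cscale: "norm (cscale z f) = cmod z * norm f"
proof -
  have "(norm (cscale z f))\<^sup>2 = (cmod z * norm f)\<^sup>2"
    by (simp add: norm_l2_power2 power_mult_distrib cscale.rep_eq norm_mult infsum_cmult_right')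
  then show ?thesis by simp
qed

lemma bounded_linear_cscale: "bounded_linear (cscale z)"
  by (rule bounded_linear_intro[where K = "cmod z"])
    (auto simp: coord_inject[symmetric] fun_eq_iff cscale.rep_eq plus_l2.rep_eq scaleR_l2.rep_eq
      distrib_left norm_cscale)

lemma inner_cscale_left: "cscale z f \<bullet> g = f \<bullet> cscale (cnj z) g"
  by (simp add: inner_l2_def cscale.rep_eq inner_complex_eq_Re algebra_simps)

lemma cscale_eq: "cscale z f = Re z *\<^sub>R f + Im z *\<^sub>R cscale \<i> f"
proof -
  have "z * w = Re z *\<^sub>R w + Im z *\<^sub>R (\<i> * w)" for w
    by (simp add: complex_eq_iff)
  then show ?thesis
    by (simp add: coord_inject[symmetric] fun_eq_iff cscale.rep_eq plus_l2.rep_eq scaleR_l2.rep_eq)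
qed

definition hermitian :: "('a \<Rightarrow> 'a \<Rightarrow> complex) \<Rightarrow> bool" where
  "hermitian k \<longleftrightarrow> (\<forall>x y. k y x = cnj (k x y))"

lemma inner_kernel_l2_hermitian:
  assumes "schur_bounded M k" "hermitian k"
  shows "kernel_l2 k f \<bullet> g = f \<bullet> kernel_l2 k g"
proof -
  have "(\<lambda>y x. cnj (k x y)) = k" using assms(2) unfolding hermitian_def by (intro ext) metis
  then show ?thesis using inner_kernel_l2_adjoint[OF assms(1), of f g] by simp
qed

definition kernel_shift :: "('a \<Rightarrow> 'a \<Rightarrow> complex) \<Rightarrow> complex \<Rightarrow> 'a l2 \<Rightarrow> 'a l2" where
  "kernel_shift k z f = kernel_l2 k f - cscale z f"

lemma bounded_linear_kernel_shift:
  "schur_bounded M k \<Longrightarrow> bounded_linear (kernel_shift k z)"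
  unfolding kernel_shift_def
  by (intro bounded_linear_sub bounded_linear_kernel_l2 bounded_linear_cscale)

text \<open>Multiplication by \<open>\<i>\<close> is skew for the real inner product and commutes
  with the symmetric operator \<open>kernel_l2 k\<close>. Hence \<open>cscale \<i> f\<close> is
  orthogonal both to \<open>f\<close> and to \<open>kernel_l2 k f\<close>, and the cross terms
  vanish. As \<open>Im z\<close> enters squared, \<open>z\<close> and \<open>cnj z\<close> give the
  same norm.\<close>

lemma norm_kernel_shift:
  assumes k: "schur_bounded M k" "hermitian k"
  shows "(norm (kernel_shift k z f))\<^sup>2 = (norm (kernel_l2 k f - Re z *\<^sub>R f))\<^sup>2 + (Im z)\<^sup>2 * (norm f)\<^sup>2"
proof -
  let ?T = "kernel_l2 k"
  note adj = inner_kernel_l2_hermitian[OF k]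
  have skew: "g \<bullet> cscale \<i> f = - (cscale \<i> g \<bullet> f)" for f g :: "'a l2"
    using cscale_eq[of "- \<i>" f] by (simp add: inner_cscale_left inner_add_right)
  have "?T f \<bullet> cscale \<i> f = 0"
  proof -
    have "?T f \<bullet> cscale \<i> f = f \<bullet> cscale \<i> (?T f)"
      by (simp add: adj kernel_l2_cscale[OF k(1)])
    also have "\<dots> = - (?T f \<bullet> cscale \<i> f)"
      using skew[of f "?T f"] by (simp add: inner_commute)
    finally show ?thesis by simp
  qed
  moreover have "f \<bullet> cscale \<i> f = 0"
    using skew[of f f] by (simp add: inner_commute)
  moreover have "cscale \<i> f \<bullet> cscale \<i> f = f \<bullet> f"
    using norm_cscale[of \<i> f] by (simp add: norm_eq_sqrt_inner)
  ultimately show ?thesis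
    unfolding kernel_shift_def cscale_eq[of z] power2_norm_eq_inner
    by (simp add: inner_diff_left inner_diff_right inner_add_left inner_add_right
        inner_commute[of f "?T f"] inner_commute[of "cscale \<i> f" f] inner_commute[of "cscale \<i> f" "?T f"]
        algebra_simps power2_eq_square)
qed

lemma kernel_shift_bounded_below_nonreal:
  assumes "schur_bounded M k" "hermitian k"
  shows "\<bar>Im z\<bar> * norm f \<le> norm (kernel_shift k z f)"
  by (rule power2_le_imp_le) (simp_all add: norm_kernel_shift[OF assms] power_mult_distrib)

text \<open>The adjoint of the shift by \<open>z\<close> is the shift by \<open>cnj z\<close>, which
  has the same norm on every vector and so inherits the lower bound.\<close>

lemma surj_kernel_shift:
  assumes k: "schur_bounded M k" "hermitian k"
    and c: "0 < c" "\<And>f. c * norm f \<le> norm (kernel_shift k z f)"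
  shows "surj (kernel_shift k z)"
proof (rule surj_if_bounded_below_adjoint)
  show "bounded_linear (kernel_shift k z)" "bounded_linear (kernel_shift k (cnj z))"
    by (intro bounded_linear_kernel_shift[OF k(1)])+
  show "kernel_shift k z f \<bullet> g = f \<bullet> kernel_shift k (cnj z) g" for f g
    by (simp add: inner_kernel_l2_hermitian[OF k] kernel_shift_def inner_diff_left inner_diff_right inner_cscale_left)
  have "(norm (kernel_shift k (cnj z) f))\<^sup>2 = (norm (kernel_shift k z f))\<^sup>2" for f
    by (simp add: norm_kernel_shift[OF k])
  then show "c * norm f \<le> norm (kernel_shift k (cnj z) f)" for f
    using c(2)[of f] by simp
qed (rule c)

section \<open>The coupled chain as a kernel operator\<close>

text \<open>A permutation of the index set acts unitarily, and the reindexed kernel is the conjugate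
  of \<open>k\<close> by it. This will be applied to translations of the two chains.\<close>

lemma kernel_shift_reindex_bounded_below:
  fixes \<sigma> :: "'a \<Rightarrow> 'a"
  assumes \<sigma>: "bij \<sigma>" and k: "schur_bounded M k"
    and below: "\<And>f. c * norm f \<le> norm (kernel_shift k z f)"
  shows "c * norm g \<le> norm (kernel_shift (\<lambda>x y. k (\<sigma> x) (\<sigma> y)) z g)"
proof -
  let ?k = "\<lambda>x y. k (\<sigma> x) (\<sigma> y)"
  have k': "schur_bounded M ?k"
    using k summable_on_reindex_bij_betw[OF \<sigma>, of "\<lambda>y. norm (k x y)" for x] summable_on_reindex_bij_betw[OF \<sigma>, of "\<lambda>x. norm (k x y)" for y]
      infsum_reindex_bij_betw[OF \<sigma>, of "\<lambda>y. norm (k x y)" for x] infsum_reindex_bij_betw[OF \<sigma>, of "\<lambda>x. norm (k x y)" for y]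
    unfolding schur_bounded_def by simp
  have inv: "bij (inv \<sigma>)" "\<And>x. inv \<sigma> (\<sigma> x) = x"
    using \<sigma> by (auto simp: bij_imp_bij_inv bij_is_inj)
  define f where "f = Abs_l2 (\<lambda>x. coord g (inv \<sigma> x))"
  have f: "coord f = (\<lambda>x. coord g (inv \<sigma> x))"
    unfolding f_def
    using summable_on_reindex_bij_betw[OF inv(1), of "\<lambda>x. (cmod (coord g x))\<^sup>2"] coord_square_summable[of g]
    by (intro Abs_l2_inverse) simp
  have "(norm f)\<^sup>2 = (norm g)\<^sup>2"
    unfolding norm_l2_power2 f
    using infsum_reindex_bij_betw[OF inv(1), of "\<lambda>x. (cmod (coord g x))\<^sup>2"] by simp
  then have norm_f: "norm f = norm g" by simp
  have "kernel_op ?k (coord g) x = kernel_op k (coord f) (\<sigma> x)" for x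
    unfolding kernel_op_def f
    using infsum_reindex_bij_betw[OF \<sigma>, of "\<lambda>y. k (\<sigma> x) y * coord g (inv \<sigma> y)"] inv(2) by simp
  then have "coord (kernel_shift ?k z g) x = coord (kernel_shift k z f) (\<sigma> x)" for x
    by (simp add: kernel_shift_def minus_l2.rep_eq cscale.rep_eq coord_kernel_l2[OF k] coord_kernel_l2[OF k'] f inv)
  then have "(norm (kernel_shift ?k z g))\<^sup>2 = (norm (kernel_shift k z f))\<^sup>2"
    unfolding norm_l2_power2
    using infsum_reindex_bij_betw[OF \<sigma>, of "\<lambda>x. (cmod (coord (kernel_shift k z f) x))\<^sup>2"] by simp
  then show ?thesis using below[of f] norm_f by simp
qed

lemma summable_exp_minus_abs_int:
  fixes c :: real
  assumes "0 < c"
  shows "(\<lambda>k::int. exp (- c * \<bar>of_int k\<bar>)) summable_on UNIV"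
proof -
  have geom: "(\<lambda>n::nat. exp (- c) ^ n) summable_on UNIV"
    using assms by (intro summable_nonneg_imp_summable_on summable_geometric) auto
  have exp_eq: "exp (- (c * real n)) = exp (- c) ^ n" for n
    by (simp add: exp_of_nat_mult[symmetric] mult.commute)
  have "k \<in> range int \<union> range (\<lambda>n. - int n)" for k
    by (cases k rule: int_cases2) auto
  then have UN: "(UNIV :: int set) = range int \<union> range (\<lambda>n. - int n)"
    by blast
  have "(\<lambda>k::int. exp (- c * \<bar>of_int k\<bar>)) summable_on range int"
    using geom by (subst summable_on_reindex) (simp_all add: o_def exp_eq)
  moreover have "(\<lambda>k::int. exp (- c * \<bar>of_int k\<bar>)) summable_on range (\<lambda>n. - int n)"
    using geom by (subst summable_on_reindex) (simp_all add: o_def exp_eq inj_on_def)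
  ultimately show ?thesis
    unfolding UN by (rule summable_on_union)
qed

text \<open>The point is that \<open>M\<close> does not depend on \<open>x\<close>. With
  \<open>a * p\<close> the lattice point at or just below \<open>x\<close>, the distance from
  \<open>x\<close> to \<open>a * m\<close> is at least \<open>a * \<bar>p - m\<bar> - a\<close>, so
  a fixed sum dominates at the cost of a factor \<open>exp (c * a)\<close>.\<close>

lemma exp_lattice_sum_bounded:
  fixes a c :: real
  assumes a: "0 < a" and c: "0 < c"
  shows "\<exists>M. \<forall>x. (\<lambda>m::int. exp (- c * \<bar>x - a * of_int m\<bar>)) summable_on UNIV \<and>
    (\<Sum>\<^sub>\<infinity>m::int. exp (- c * \<bar>x - a * of_int m\<bar>)) \<le> M"
proof (intro exI allI)
  fix x :: real
  define p where "p = \<lfloor>x / a\<rfloor>"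
  let ?g = "\<lambda>k::int. exp (c * a) * exp (- (c * a) * \<bar>of_int k\<bar>)"
  have g: "?g summable_on UNIV"
    using a c by (intro summable_on_cmult_right summable_exp_minus_abs_int) simp
  have bij: "bij (\<lambda>m. p - m)"
    by (rule bij_betw_byWitness[where f' = "\<lambda>m. p - m"]) auto
  have gp: "(\<lambda>m. ?g (p - m)) summable_on UNIV" "(\<Sum>\<^sub>\<infinity>m. ?g (p - m)) = infsum ?g UNIV"
    using summable_on_reindex_bij_betw[OF bij, of ?g] infsum_reindex_bij_betw[OF bij, of ?g] g by auto
  have "exp (- c * \<bar>x - a * of_int m\<bar>) \<le> ?g (p - m)" for m
  proof -
    have "a * of_int p \<le> x" "x \<le> a * of_int p + a"
      using a floor_divide_lower[of a x] floor_divide_upper[of a x] by (auto simp: p_def algebra_simps)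
    moreover have "a * \<bar>of_int (p - m)\<bar> = \<bar>a * of_int p - a * of_int m\<bar>"
      using a by (simp add: abs_mult flip: right_diff_distrib)
    ultimately have "a * \<bar>of_int (p - m)\<bar> - a \<le> \<bar>x - a * of_int m\<bar>" by linarith
    then have "c * (a * \<bar>of_int (p - m)\<bar> - a) \<le> c * \<bar>x - a * of_int m\<bar>"
      using c by (intro mult_left_mono) auto
    then show ?thesis by (simp add: algebra_simps flip: exp_add)
  qed
  then show "(\<lambda>m::int. exp (- c * \<bar>x - a * of_int m\<bar>)) summable_on UNIV \<and>
    (\<Sum>\<^sub>\<infinity>m::int. exp (- c * \<bar>x - a * of_int m\<bar>)) \<le> infsum ?g UNIV"
    using gp by (intro summable_infsum_le_mono[OF gp(1)]) auto
qed

lemma has_sum_sum_type: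
  fixes f :: "'a + 'b \<Rightarrow> 'c::topological_comm_monoid_add"
  assumes "((\<lambda>x. f (Inl x)) has_sum s) UNIV" "((\<lambda>x. f (Inr x)) has_sum t) UNIV"
  shows "(f has_sum (s + t)) UNIV"
proof -
  have "(f has_sum s) (range Inl)" "(f has_sum t) (range Inr)"
    using assms by (auto simp: has_sum_reindex o_def)
  then have "(f has_sum (s + t)) (range Inl \<union> range Inr)"
    by (intro has_sum_Un_disjoint) auto
  then show ?thesis by (simp flip: UNIV_sum)
qed

definition site_kernel :: "(int \<Rightarrow> real) \<Rightarrow> int \<Rightarrow> int \<Rightarrow> complex" where
  "site_kernel \<omega> n m =
     (if m = n then 2 + complex_of_real (\<omega> n) else if m = n + 1 \<or> m = n - 1 then - 1 else 0)"

lemma site_kernel_has_sum: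
  "((\<lambda>m. site_kernel \<omega> n m * \<phi> m) has_sum
     (- discrete_laplacian \<phi> n + complex_of_real (\<omega> n) * \<phi> n)) UNIV"
  by (rule has_sum_finite_neutralI[of "{n - 1, n, n + 1}"])
    (auto simp: site_kernel_def discrete_laplacian_def algebra_simps)

lemma norm_site_kernel_has_sum:
  "((\<lambda>m. norm (site_kernel \<omega> n m)) has_sum (2 + cmod (2 + complex_of_real (\<omega> n)))) UNIV"
  by (rule has_sum_finite_neutralI[of "{n - 1, n, n + 1}"]) (auto simp: site_kernel_def)

text \<open>Indexing by \<open>int + int\<close> merges both chains into one sequence space, with
  the couplings as off-diagonal blocks of a single kernel.\<close>

fun chain_kernel ::
  "(real \<Rightarrow> real) \<Rightarrow> real \<Rightarrow> real \<Rightarrow> (int \<Rightarrow> real) \<Rightarrow> (int \<Rightarrow> real) \<Rightarrow> int + int \<Rightarrow> int + int \<Rightarrow> complex" where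
  "chain_kernel h \<theta> b \<omega>\<^sub>1 \<omega>\<^sub>2 (Inl n) (Inl m) = site_kernel \<omega>\<^sub>1 n m"
| "chain_kernel h \<theta> b \<omega>\<^sub>1 \<omega>\<^sub>2 (Inl n) (Inr m) = complex_of_real (h (of_int n - (1 - \<theta>) * of_int m - b))"
| "chain_kernel h \<theta> b \<omega>\<^sub>1 \<omega>\<^sub>2 (Inr n) (Inl m) = complex_of_real (h ((1 - \<theta>) * of_int n + b - of_int m))"
| "chain_kernel h \<theta> b \<omega>\<^sub>1 \<omega>\<^sub>2 (Inr n) (Inr m) = site_kernel \<omega>\<^sub>2 n m"

lemma hermitian_chain_kernel:
  assumes "even_function h"
  shows "hermitian (chain_kernel h \<theta> b \<omega>\<^sub>1 \<omega>\<^sub>2)"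
  unfolding hermitian_def
proof (intro allI)
  \<comment> \<open>The two coupling arguments differ by a sign, so evenness of \<open>h\<close>
    makes the off-diagonal blocks adjoint to each other.\<close>
  have sym: "h (of_int n - (1 - \<theta>) * of_int m - b) = h ((1 - \<theta>) * of_int m + b - of_int n)" for n m :: int
    using assms[unfolded even_function_def, rule_format, of "of_int n - (1 - \<theta>) * of_int m - b"]
    by (simp add: algebra_simps)
  show "chain_kernel h \<theta> b \<omega>\<^sub>1 \<omega>\<^sub>2 y x = cnj (chain_kernel h \<theta> b \<omega>\<^sub>1 \<omega>\<^sub>2 x y)" for x y
    by (cases x; cases y) (auto simp: site_kernel_def sym)
qed

lemma schur_bounded_chain_kernel:
  assumes \<theta>: "\<theta> < 1" and even: "even_function h"
    and C: "0 \<le> C" and c: "0 < c" and decay: "\<And>x. \<bar>h x\<bar> \<le> C * exp (- c * \<bar>x\<bar>)"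
    and \<omega>: "\<And>n. \<bar>\<omega>\<^sub>1 n\<bar> \<le> R" "\<And>n. \<bar>\<omega>\<^sub>2 n\<bar> \<le> R"
  shows "\<exists>M. schur_bounded M (chain_kernel h \<theta> b \<omega>\<^sub>1 \<omega>\<^sub>2)"
proof -
  let ?K = "chain_kernel h \<theta> b \<omega>\<^sub>1 \<omega>\<^sub>2"
  obtain M1 where M1: "\<And>x. (\<lambda>m::int. exp (- c * \<bar>x - (1 - \<theta>) * of_int m\<bar>)) summable_on UNIV \<and>
    (\<Sum>\<^sub>\<infinity>m::int. exp (- c * \<bar>x - (1 - \<theta>) * of_int m\<bar>)) \<le> M1"
    using exp_lattice_sum_bounded[of "1 - \<theta>" c] \<theta> c by auto
  obtain M2 where M2: "\<And>x. (\<lambda>m::int. exp (- c * \<bar>x - of_int m\<bar>)) summable_on UNIV \<and>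
    (\<Sum>\<^sub>\<infinity>m::int. exp (- c * \<bar>x - of_int m\<bar>)) \<le> M2"
    using exp_lattice_sum_bounded[of 1 c] c by auto
  \<comment> \<open>\<open>4 + R\<close> bounds the part of a row inside one chain: two neighbours
    of modulus \<open>1\<close> and a diagonal entry of modulus at most \<open>2 + R\<close>.
    \<open>M1\<close> and \<open>M2\<close> serve the couplings, whose arguments run through
    lattices of spacing \<open>1 - \<theta>\<close> and \<open>1\<close>.\<close>
  define M where "M = 4 + R + C * max M1 M2"
  have site: "2 + cmod (2 + complex_of_real r) \<le> 4 + R" if "\<bar>r\<bar> \<le> R" for r
    using norm_triangle_ineq[of 2 "complex_of_real r"] that by simp
  have off: "(\<lambda>m. \<bar>h (u m)\<bar>) summable_on UNIV \<and> (\<Sum>\<^sub>\<infinity>m. \<bar>h (u m)\<bar>) \<le> C * max M1 M2"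
    if s: "(\<lambda>m::int. exp (- c * \<bar>u m\<bar>)) summable_on UNIV" and
      le: "(\<Sum>\<^sub>\<infinity>m::int. exp (- c * \<bar>u m\<bar>)) \<le> max M1 M2" for u :: "int \<Rightarrow> real"
  proof (rule summable_infsum_le_mono)
    show "(\<lambda>m. C * exp (- c * \<bar>u m\<bar>)) summable_on UNIV"
      by (intro summable_on_cmult_right s)
    show "(\<Sum>\<^sub>\<infinity>m. C * exp (- c * \<bar>u m\<bar>)) \<le> C * max M1 M2"
      using C le by (simp add: infsum_cmult_right' mult_left_mono)
  qed (use decay in auto)
  have row: "(\<lambda>y. norm (?K x y)) summable_on UNIV \<and> (\<Sum>\<^sub>\<infinity>y. norm (?K x y)) \<le> M" for x
  proof (cases x)
    case (Inl n)
    have "(\<lambda>m. \<bar>h (of_int n - (1 - \<theta>) * of_int m - b)\<bar>) summable_on UNIV \<and>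
        (\<Sum>\<^sub>\<infinity>m. \<bar>h (of_int n - (1 - \<theta>) * of_int m - b)\<bar>) \<le> C * max M1 M2"
      using M1[of "of_int n - b"] by (intro off) (auto simp: algebra_simps)
    then have "((\<lambda>m. norm (?K x (Inr m))) has_sum (\<Sum>\<^sub>\<infinity>m. norm (?K x (Inr m)))) UNIV \<and>
        (\<Sum>\<^sub>\<infinity>m. norm (?K x (Inr m))) \<le> C * max M1 M2"
      by (simp add: Inl has_sum_infsum)
    moreover have "((\<lambda>m. norm (?K x (Inl m))) has_sum (2 + cmod (2 + complex_of_real (\<omega>\<^sub>1 n)))) UNIV"
      using norm_site_kernel_has_sum by (simp add: Inl)
    ultimately have "((\<lambda>y. norm (?K x y)) has_sum (2 + cmod (2 + complex_of_real (\<omega>\<^sub>1 n)) + (\<Sum>\<^sub>\<infinity>m. norm (?K x (Inr m))))) UNIV"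
      "(2 + cmod (2 + complex_of_real (\<omega>\<^sub>1 n)) + (\<Sum>\<^sub>\<infinity>m. norm (?K x (Inr m)))) \<le> M"
      using site[OF \<omega>(1)[of n]] by (auto intro: has_sum_sum_type simp: M_def)
    then show ?thesis by (auto simp: has_sum_iff)
  next
    case (Inr n)
    have "(\<lambda>m. \<bar>h ((1 - \<theta>) * of_int n + b - of_int m)\<bar>) summable_on UNIV \<and>
        (\<Sum>\<^sub>\<infinity>m. \<bar>h ((1 - \<theta>) * of_int n + b - of_int m)\<bar>) \<le> C * max M1 M2"
      using M2[of "(1 - \<theta>) * of_int n + b"] by (intro off) auto
    then have "((\<lambda>m. norm (?K x (Inl m))) has_sum (\<Sum>\<^sub>\<infinity>m. norm (?K x (Inl m)))) UNIV \<and>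
        (\<Sum>\<^sub>\<infinity>m. norm (?K x (Inl m))) \<le> C * max M1 M2"
      by (simp add: Inr has_sum_infsum)
    moreover have "((\<lambda>m. norm (?K x (Inr m))) has_sum (2 + cmod (2 + complex_of_real (\<omega>\<^sub>2 n)))) UNIV"
      using norm_site_kernel_has_sum by (simp add: Inr)
    ultimately have "((\<lambda>y. norm (?K x y)) has_sum ((\<Sum>\<^sub>\<infinity>m. norm (?K x (Inl m))) + (2 + cmod (2 + complex_of_real (\<omega>\<^sub>2 n))))) UNIV"
      "((\<Sum>\<^sub>\<infinity>m. norm (?K x (Inl m))) + (2 + cmod (2 + complex_of_real (\<omega>\<^sub>2 n)))) \<le> M"
      using site[OF \<omega>(2)[of n]] by (auto intro: has_sum_sum_type simp: M_def)
    then show ?thesis by (auto simp: has_sum_iff)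
  qed
  \<comment> \<open>By this symmetry of the moduli, column sums are row sums.\<close>
  have "norm (?K x y) = norm (?K y x)" for x y
    using hermitian_chain_kernel[OF even, of \<theta> b \<omega>\<^sub>1 \<omega>\<^sub>2] unfolding hermitian_def
    by (metis complex_mod_cnj)
  then have "schur_bounded M ?K"
    using row unfolding schur_bounded_def by (metis (no_types, lifting) infsum_cong summable_on_cong)
  then show ?thesis ..
qed

section \<open>Transfer to pairs of sequences and the spectrum\<close>

definition unpack :: "(int + int) l2 \<Rightarrow> chain_pair" where
  "unpack f = ((\<lambda>n. coord f (Inl n)), (\<lambda>n. coord f (Inr n)))"

lemma square_summable_sum_type:
  fixes f :: "'a + 'b \<Rightarrow> complex"
  shows "(\<lambda>x. (cmod (f x))\<^sup>2) summable_on UNIV \<longleftrightarrow>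
    (\<lambda>x. (cmod (f (Inl x)))\<^sup>2) summable_on UNIV \<and> (\<lambda>x. (cmod (f (Inr x)))\<^sup>2) summable_on UNIV"
proof safe
  assume f: "(\<lambda>x. (cmod (f x))\<^sup>2) summable_on UNIV"
  have "(\<lambda>x. (cmod (f x))\<^sup>2) summable_on range Inl" "(\<lambda>x. (cmod (f x))\<^sup>2) summable_on range Inr"
    by (rule summable_on_subset[OF f]; simp)+
  then show "(\<lambda>x. (cmod (f (Inl x)))\<^sup>2) summable_on UNIV" "(\<lambda>x. (cmod (f (Inr x)))\<^sup>2) summable_on UNIV"
    by (auto simp: summable_on_reindex o_def)
next
  assume "(\<lambda>x. (cmod (f (Inl x)))\<^sup>2) summable_on UNIV" "(\<lambda>x. (cmod (f (Inr x)))\<^sup>2) summable_on UNIV"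
  then show "(\<lambda>x. (cmod (f x))\<^sup>2) summable_on UNIV"
    using has_sum_sum_type[of "\<lambda>x. (cmod (f x))\<^sup>2"] unfolding summable_on_def by blast
qed

lemma bij_betw_unpack: "bij_betw unpack UNIV ell2_sum"
proof (rule bij_betw_byWitness[where f' = "\<lambda>\<psi>. Abs_l2 (case_sum (fst \<psi>) (snd \<psi>))"])
  have "case_sum (\<lambda>n. coord f (Inl n)) (\<lambda>n. coord f (Inr n)) = coord f" for f :: "(int + int) l2"
    by (rule ext) (simp split: sum.split)
  then show "\<forall>f\<in>UNIV. Abs_l2 (case_sum (fst (unpack f)) (snd (unpack f))) = f"
    by (simp add: unpack_def coord_inverse)
  show "\<forall>\<psi>\<in>ell2_sum. unpack (Abs_l2 (case_sum (fst \<psi>) (snd \<psi>))) = \<psi>"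
  proof
    fix \<psi> assume "\<psi> \<in> ell2_sum"
    then have "(\<lambda>x. (cmod (case_sum (fst \<psi>) (snd \<psi>) x))\<^sup>2) summable_on UNIV"
      by (subst square_summable_sum_type) (auto simp: ell2_sum_def ell2_def)
    then show "unpack (Abs_l2 (case_sum (fst \<psi>) (snd \<psi>))) = \<psi>"
      by (simp add: unpack_def Abs_l2_inverse)
  qed
  show "unpack ` UNIV \<subseteq> ell2_sum"
    using coord_square_summable[where 'a = "int + int"]
    by (auto simp: unpack_def ell2_sum_def ell2_def square_summable_sum_type)
qed auto

lemma ell2_sum_eq_range: "ell2_sum = range unpack"
  using bij_betw_unpack by (simp add: bij_betw_def)

lemma unpack_in_ell2_sum: "unpack f \<in> ell2_sum"
  by (simp add: ell2_sum_eq_range)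

lemma ell2_norm_unpack: "ell2_norm (unpack f) = norm f"
proof -
  have "((\<lambda>x. (cmod (coord f x))\<^sup>2) has_sum
     ((\<Sum>\<^sub>\<infinity>n. (cmod (coord f (Inl n)))\<^sup>2) + (\<Sum>\<^sub>\<infinity>n. (cmod (coord f (Inr n)))\<^sup>2))) UNIV"
    using coord_square_summable[of f] by (intro has_sum_sum_type has_sum_infsum) (auto simp: square_summable_sum_type)
  then have eq: "(norm f)\<^sup>2 = (\<Sum>\<^sub>\<infinity>n. (cmod (coord f (Inl n)))\<^sup>2) + (\<Sum>\<^sub>\<infinity>n. (cmod (coord f (Inr n)))\<^sup>2)"
    unfolding norm_l2_power2 by (rule infsumI)
  have "ell2_norm (unpack f) = sqrt ((norm f)\<^sup>2)"
    unfolding eq by (simp add: ell2_norm_def unpack_def)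
  then show ?thesis by simp
qed

lemma coupled_chain_unpack:
  assumes k: "schur_bounded M (chain_kernel h \<theta> b \<omega>\<^sub>1 \<omega>\<^sub>2)"
  shows "coupled_chain h \<theta> b \<omega>\<^sub>1 \<omega>\<^sub>2 (unpack f) = unpack (kernel_l2 (chain_kernel h \<theta> b \<omega>\<^sub>1 \<omega>\<^sub>2) f)"
proof -
  let ?K = "chain_kernel h \<theta> b \<omega>\<^sub>1 \<omega>\<^sub>2"
  have summ: "(\<lambda>y. ?K x y * coord f y) summable_on UNIV" for x
    by (rule kernel_op_row_summable[OF k coord_square_summable])
  have "(\<lambda>y. ?K x y * coord f y) summable_on range Inl" "(\<lambda>y. ?K x y * coord f y) summable_on range Inr" for x
    by (rule summable_on_subset[OF summ]; simp)+
  then have summ': "((\<lambda>m. ?K x (Inl m) * coord f (Inl m)) has_sum (\<Sum>\<^sub>\<infinity>m. ?K x (Inl m) * coord f (Inl m))) UNIV"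
    "((\<lambda>m. ?K x (Inr m) * coord f (Inr m)) has_sum (\<Sum>\<^sub>\<infinity>m. ?K x (Inr m) * coord f (Inr m))) UNIV" for x
    by (auto simp: summable_on_reindex o_def)
  have "kernel_op ?K (coord f) (Inl n) =
      (- discrete_laplacian (\<lambda>n. coord f (Inl n)) n + complex_of_real (\<omega>\<^sub>1 n) * coord f (Inl n)) +
      (\<Sum>\<^sub>\<infinity>m. ?K (Inl n) (Inr m) * coord f (Inr m))" for n
    unfolding kernel_op_def
    by (intro infsumI has_sum_sum_type summ'(2)) (use site_kernel_has_sum in simp)
  moreover have "kernel_op ?K (coord f) (Inr n) =
      (\<Sum>\<^sub>\<infinity>m. ?K (Inr n) (Inl m) * coord f (Inl m)) +
      (- discrete_laplacian (\<lambda>n. coord f (Inr n)) n + complex_of_real (\<omega>\<^sub>2 n) * coord f (Inr n))" for n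
    unfolding kernel_op_def
    by (intro infsumI has_sum_sum_type summ'(1)) (use site_kernel_has_sum in simp)
  ultimately show ?thesis
    by (simp add: coupled_chain_def unpack_def coord_kernel_l2[OF k] add.commute)
qed

lemma coupled_chain_domain_bounded:
  assumes "schur_bounded M (chain_kernel h \<theta> b \<omega>\<^sub>1 \<omega>\<^sub>2)"
  shows "coupled_chain_domain h \<theta> b \<omega>\<^sub>1 \<omega>\<^sub>2 = ell2_sum"
proof -
  have "coupled_chain h \<theta> b \<omega>\<^sub>1 \<omega>\<^sub>2 \<psi> \<in> ell2_sum" if "\<psi> \<in> ell2_sum" for \<psi>
  proof -
    from that obtain f where "\<psi> = unpack f" unfolding ell2_sum_eq_range by (rule rangeE)
    then show ?thesis using coupled_chain_unpack[OF assms] unpack_in_ell2_sum by simp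
  qed
  then show ?thesis by (auto simp: coupled_chain_domain_def)
qed

text \<open>A Schur bound makes the maximal domain all of \<open>ell2_sum\<close>, so the resolvent
  condition can be read on \<open>l2\<close>. Injectivity and the bound \<open>1 / c\<close> for the
  inverse come from the lower bound itself, surjectivity from
  \<open>surj_kernel_shift\<close>.\<close>

lemma not_in_coupled_chain_spectrum_iff:
  assumes even: "even_function h" and k: "schur_bounded M (chain_kernel h \<theta> b \<omega>\<^sub>1 \<omega>\<^sub>2)"
  shows "z \<notin> coupled_chain_spectrum h \<theta> b \<omega>\<^sub>1 \<omega>\<^sub>2 \<longleftrightarrow>
    (\<exists>c>0. \<forall>f. c * norm f \<le> norm (kernel_shift (chain_kernel h \<theta> b \<omega>\<^sub>1 \<omega>\<^sub>2) z f))"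
proof -
  let ?K = "chain_kernel h \<theta> b \<omega>\<^sub>1 \<omega>\<^sub>2"
  define T where "T = shifted_op (coupled_chain h \<theta> b \<omega>\<^sub>1 \<omega>\<^sub>2) z"
  define S where "S = kernel_shift ?K z"
  have T: "T (unpack f) = unpack (S f)" for f
    unfolding T_def S_def shifted_op_def coupled_chain_unpack[OF k]
    by (simp add: unpack_def kernel_shift_def minus_l2.rep_eq cscale.rep_eq)
  interpret S: bounded_linear S unfolding S_def by (rule bounded_linear_kernel_shift[OF k])
  have inj_unpack: "unpack f = unpack g \<longleftrightarrow> f = g" for f g
    using bij_betw_unpack by (auto simp: bij_betw_def inj_on_def)
  have resolvent: "z \<notin> coupled_chain_spectrum h \<theta> b \<omega>\<^sub>1 \<omega>\<^sub>2 \<longleftrightarrow>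
    bij_betw T ell2_sum ell2_sum \<and> (\<exists>C. \<forall>\<eta>\<in>ell2_sum. ell2_norm (inv_into ell2_sum T \<eta>) \<le> C * ell2_norm \<eta>)"
    by (simp add: coupled_chain_spectrum_def op_spectrum_def resolvent_set_def coupled_chain_domain_bounded[OF k] T_def)
  show ?thesis
    unfolding resolvent S_def[symmetric]
  proof
    assume "bij_betw T ell2_sum ell2_sum \<and> (\<exists>C. \<forall>\<eta>\<in>ell2_sum. ell2_norm (inv_into ell2_sum T \<eta>) \<le> C * ell2_norm \<eta>)"
    then obtain C where bij: "bij_betw T ell2_sum ell2_sum"
      and C: "\<And>\<eta>. \<eta> \<in> ell2_sum \<Longrightarrow> ell2_norm (inv_into ell2_sum T \<eta>) \<le> C * ell2_norm \<eta>" by blast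
    have le: "norm f \<le> C * norm (S f)" for f
      using C[OF unpack_in_ell2_sum, of "S f"] bij_betw_inv_into_left[OF bij unpack_in_ell2_sum, of f]
      by (simp add: T ell2_norm_unpack)
    \<comment> \<open>The definition of the resolvent set does not make \<open>C\<close> positive,
      hence the maximum with \<open>1\<close>.\<close>
    have "1 / max C 1 * norm f \<le> norm (S f)" for f
    proof -
      have "C * norm (S f) \<le> max C 1 * norm (S f)" by (intro mult_right_mono) auto
      with le[of f] have "norm f \<le> max C 1 * norm (S f)" by linarith
      then show ?thesis by (simp add: divide_le_eq mult.commute)
    qed
    then show "\<exists>c>0. \<forall>f. c * norm f \<le> norm (S f)"
      by (intro exI[of _ "1 / max C 1"]) auto
  next
    assume "\<exists>c>0. \<forall>f. c * norm f \<le> norm (S f)"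
    then obtain c where c: "c > 0" "\<And>f. c * norm f \<le> norm (S f)" by blast
    have surj: "surj S"
      unfolding S_def by (rule surj_kernel_shift[OF k hermitian_chain_kernel[OF even] c[unfolded S_def]])
    have inj: "f = g" if "S f = S g" for f g
      using c(2)[of "f - g"] c(1) that by (simp add: S.diff mult_le_0_iff)
    have bij: "bij_betw T ell2_sum ell2_sum"
      unfolding bij_betw_def
    proof
      show "inj_on T ell2_sum"
        unfolding ell2_sum_eq_range by (auto simp: inj_on_def T inj_unpack dest: inj)
      have "T ` ell2_sum = unpack ` range S"
        unfolding ell2_sum_eq_range by (auto simp: T image_iff)
      then show "T ` ell2_sum = ell2_sum" by (simp add: surj ell2_sum_eq_range)
    qed
    moreover have "ell2_norm (inv_into ell2_sum T \<eta>) \<le> (1 / c) * ell2_norm \<eta>" if "\<eta> \<in> ell2_sum" for \<eta>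
    proof -
      from that obtain g where "\<eta> = unpack g" unfolding ell2_sum_eq_range by (rule rangeE)
      moreover obtain f where "g = S f" using surj by (metis surjD)
      ultimately have \<eta>: "\<eta> = T (unpack f)" "ell2_norm \<eta> = norm (S f)"
        by (simp_all add: T ell2_norm_unpack)
      show ?thesis
        using c(2)[of f] c(1) bij_betw_inv_into_left[OF bij unpack_in_ell2_sum, of f]
        by (simp add: \<eta>(2)) (simp add: \<eta>(1) ell2_norm_unpack field_simps)
    qed
    ultimately show "bij_betw T ell2_sum ell2_sum \<and>
        (\<exists>C. \<forall>\<eta>\<in>ell2_sum. ell2_norm (inv_into ell2_sum T \<eta>) \<le> C * ell2_norm \<eta>)" by blast
  qed
qed

lemma coupled_chain_spectrum_real:
  assumes "even_function h" and "schur_bounded M (chain_kernel h \<theta> b \<omega>\<^sub>1 \<omega>\<^sub>2)"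
    and "z \<in> coupled_chain_spectrum h \<theta> b \<omega>\<^sub>1 \<omega>\<^sub>2"
  shows "z \<in> \<real>"
proof (rule ccontr)
  assume "z \<notin> \<real>"
  then have "\<bar>Im z\<bar> > 0" by (simp add: complex_is_Real_iff)
  with kernel_shift_bounded_below_nonreal[OF assms(2) hermitian_chain_kernel[OF assms(1)]]
  have "z \<notin> coupled_chain_spectrum h \<theta> b \<omega>\<^sub>1 \<omega>\<^sub>2"
    unfolding not_in_coupled_chain_spectrum_iff[OF assms(1,2)] by blast
  with assms(3) show False by blast
qed

section \<open>Translations and strong limits\<close>

lemma chain_kernel_translate:
  "chain_kernel h \<theta> b \<omega>\<^sub>1 \<omega>\<^sub>2 (map_sum (\<lambda>n. n + k) (\<lambda>n. n + l) x) (map_sum (\<lambda>n. n + k) (\<lambda>n. n + l) y) =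
   chain_kernel h \<theta> (b - of_int k + (1 - \<theta>) * of_int l) (\<lambda>n. \<omega>\<^sub>1 (n + k)) (\<lambda>n. \<omega>\<^sub>2 (n + l)) x y"
  by (cases x; cases y) (auto simp: site_kernel_def algebra_simps)

text \<open>The translates of the operator at \<open>(b, \<omega>)\<close> converge strongly to the operator at \<open>(b', \<omega>')\<close>,
  and they all have the same lower bound.\<close>

lemma coupled_chain_spectrum_subset:
  assumes \<theta>: "\<theta> < 1" and even: "even_function h" and cont: "continuous_on UNIV h"
    and decay: "exponentially_decaying h"
    and R: "\<And>n. \<bar>\<omega>\<^sub>1 n\<bar> \<le> R" "\<And>n. \<bar>\<omega>\<^sub>2 n\<bar> \<le> R" "\<And>n. \<bar>\<omega>\<^sub>1' n\<bar> \<le> R" "\<And>n. \<bar>\<omega>\<^sub>2' n\<bar> \<le> R"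
    and recur: "\<And>N::nat. \<exists>k l. \<bar>b - of_int k + (1 - \<theta>) * of_int l - b'\<bar> < 1 / Suc N \<and>
      (\<forall>j. \<bar>j\<bar> \<le> int N \<longrightarrow> \<bar>\<omega>\<^sub>1 (j + k) - \<omega>\<^sub>1' j\<bar> < 1 / Suc N \<and> \<bar>\<omega>\<^sub>2 (j + l) - \<omega>\<^sub>2' j\<bar> < 1 / Suc N)"
  shows "coupled_chain_spectrum h \<theta> b' \<omega>\<^sub>1' \<omega>\<^sub>2' \<subseteq> coupled_chain_spectrum h \<theta> b \<omega>\<^sub>1 \<omega>\<^sub>2"
proof
  fix z assume z: "z \<in> coupled_chain_spectrum h \<theta> b' \<omega>\<^sub>1' \<omega>\<^sub>2'"
  obtain C c where C: "C > 0" and c: "c > 0" and h: "\<And>x. \<bar>h x\<bar> \<le> C * exp (- c * \<bar>x\<bar>)"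
    using decay by (auto simp: exponentially_decaying_def)
  have R0: "0 \<le> R" using R(1)[of 0] by linarith
  have schur: "\<exists>M. schur_bounded M (chain_kernel h \<theta> b \<omega>\<^sub>1 \<omega>\<^sub>2)"
    "\<exists>M. schur_bounded M (chain_kernel h \<theta> b' \<omega>\<^sub>1' \<omega>\<^sub>2')"
    using schur_bounded_chain_kernel[OF \<theta> even less_imp_le[OF C] c h] R by blast+
  then obtain M M' where M: "schur_bounded M (chain_kernel h \<theta> b \<omega>\<^sub>1 \<omega>\<^sub>2)"
    and M': "schur_bounded M' (chain_kernel h \<theta> b' \<omega>\<^sub>1' \<omega>\<^sub>2')" by blast
  \<comment> \<open>Profile of a dominating kernel that is independent of \<open>N\<close>: moving
    the argument of \<open>h\<close> by at most \<open>1\<close> costs a factor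
    \<open>exp c\<close>. The constant potential \<open>R\<close> gives the largest diagonal entry
    among potentials bounded by \<open>R\<close>.\<close>
  define g where "g x = (C * exp c) * exp (- c * \<bar>x\<bar>)" for x
  let ?D = "chain_kernel g \<theta> b' (\<lambda>_. R) (\<lambda>_. R)"
  have "\<exists>M. schur_bounded M ?D"
    using C R0 by (intro schur_bounded_chain_kernel[OF \<theta> _ _ c, of _ "C * exp c"])
      (auto simp: even_function_def g_def)
  then obtain MD where MD: "schur_bounded MD ?D" by blast
  obtain k l :: "nat \<Rightarrow> int" where kl: "\<And>N. \<bar>b - of_int (k N) + (1 - \<theta>) * of_int (l N) - b'\<bar> < 1 / Suc N"
    "\<And>N j. \<bar>j\<bar> \<le> int N \<Longrightarrow> \<bar>\<omega>\<^sub>1 (j + k N) - \<omega>\<^sub>1' j\<bar> < 1 / Suc N"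
    "\<And>N j. \<bar>j\<bar> \<le> int N \<Longrightarrow> \<bar>\<omega>\<^sub>2 (j + l N) - \<omega>\<^sub>2' j\<bar> < 1 / Suc N"
    using recur by metis
  define \<beta> where "\<beta> N = b - of_int (k N) + (1 - \<theta>) * of_int (l N)" for N
  define K where "K N = chain_kernel h \<theta> (\<beta> N) (\<lambda>n. \<omega>\<^sub>1 (n + k N)) (\<lambda>n. \<omega>\<^sub>2 (n + l N))" for N
  have lim0: "(\<lambda>N. 1 / real (Suc N)) \<longlonglongrightarrow> 0"
    using lim_inverse_n'[THEN LIMSEQ_Suc] by simp
  have \<beta>_lim: "\<beta> \<longlonglongrightarrow> b'"
  proof (rule LIM_zero_cancel, rule Lim_null_comparison[OF _ lim0])
    show "\<forall>\<^sub>F N in sequentially. norm (\<beta> N - b') \<le> 1 / real (Suc N)"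
      using kl(1) by (intro always_eventually) (auto simp: \<beta>_def less_imp_le)
  qed
  have \<omega>_lim: "(\<lambda>N. u (j + s N)) \<longlonglongrightarrow> u' j"
    if "\<And>N j. \<bar>j\<bar> \<le> int N \<Longrightarrow> \<bar>u (j + s N) - u' j\<bar> < 1 / Suc N"
    for u u' :: "int \<Rightarrow> real" and s :: "nat \<Rightarrow> int" and j
  proof (rule LIM_zero_cancel, rule Lim_null_comparison[OF _ lim0])
    show "\<forall>\<^sub>F N in sequentially. norm (u (j + s N) - u' j) \<le> 1 / real (Suc N)"
      unfolding eventually_sequentially
    proof (intro exI allI impI)
      fix N assume "nat \<bar>j\<bar> \<le> N"
      then show "norm (u (j + s N) - u' j) \<le> 1 / real (Suc N)"
        using that[of j N] by (simp add: less_imp_le)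
    qed
  qed
  have h_lim: "(\<lambda>N. h (u N)) \<longlonglongrightarrow> h v" if "u \<longlonglongrightarrow> v" for u v
    using continuous_on_tendsto_compose[OF cont that] by simp
  have lim: "(\<lambda>N. K N x y) \<longlonglongrightarrow> chain_kernel h \<theta> b' \<omega>\<^sub>1' \<omega>\<^sub>2' x y" for x y
    unfolding K_def
    by (cases x; cases y)
      (auto simp: site_kernel_def intro!: tendsto_intros h_lim \<beta>_lim \<omega>_lim kl(2,3))
  have \<beta>_near: "\<bar>\<beta> N - b'\<bar> \<le> 1" for N
  proof -
    have "1 / real (Suc N) \<le> 1" by simp
    then show ?thesis using kl(1)[of N] unfolding \<beta>_def by linarith
  qed
  have h_le: "\<bar>h x\<bar> \<le> g y" if "\<bar>x - y\<bar> \<le> 1" for x y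
  proof -
    have "c * \<bar>y\<bar> \<le> c * (1 + \<bar>x\<bar>)" using that c by (intro mult_left_mono) auto
    then have "exp (- c * \<bar>x\<bar>) \<le> exp (c + - c * \<bar>y\<bar>)" by (simp add: algebra_simps)
    then have "C * exp (- c * \<bar>x\<bar>) \<le> C * exp (c + - c * \<bar>y\<bar>)" using C by (intro mult_left_mono) auto
    also have "\<dots> = g y" by (simp add: g_def flip: exp_add)
    finally show ?thesis using h[of x] by linarith
  qed
  have site_le: "cmod (2 + complex_of_real r) \<le> cmod (2 + complex_of_real R)" if "\<bar>r\<bar> \<le> R" for r
    using norm_triangle_ineq[of 2 "complex_of_real r"] that R0 norm_of_real[of "2 + R", where 'a = complex]
    by simp
  have bound: "norm (K N x y) \<le> norm (?D x y)" for N x y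
    unfolding K_def
  proof (cases x; cases y; (simp only:)?)
    fix n m
    show "cmod (chain_kernel h \<theta> (\<beta> N) (\<lambda>n. \<omega>\<^sub>1 (n + k N)) (\<lambda>n. \<omega>\<^sub>2 (n + l N)) (Inl n) (Inl m)) \<le> cmod (?D (Inl n) (Inl m))"
      by (simp add: site_kernel_def site_le R)
    show "cmod (chain_kernel h \<theta> (\<beta> N) (\<lambda>n. \<omega>\<^sub>1 (n + k N)) (\<lambda>n. \<omega>\<^sub>2 (n + l N)) (Inr n) (Inr m)) \<le> cmod (?D (Inr n) (Inr m))"
      by (simp add: site_kernel_def site_le R)
    show "cmod (chain_kernel h \<theta> (\<beta> N) (\<lambda>n. \<omega>\<^sub>1 (n + k N)) (\<lambda>n. \<omega>\<^sub>2 (n + l N)) (Inl n) (Inr m)) \<le> cmod (?D (Inl n) (Inr m))"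
      using \<beta>_near[of N] by simp (intro order_trans[OF h_le abs_ge_self]; simp)
    show "cmod (chain_kernel h \<theta> (\<beta> N) (\<lambda>n. \<omega>\<^sub>1 (n + k N)) (\<lambda>n. \<omega>\<^sub>2 (n + l N)) (Inr n) (Inl m)) \<le> cmod (?D (Inr n) (Inl m))"
      using \<beta>_near[of N] by simp (intro order_trans[OF h_le abs_ge_self]; simp)
  qed
  show "z \<in> coupled_chain_spectrum h \<theta> b \<omega>\<^sub>1 \<omega>\<^sub>2"
  proof (rule ccontr)
    assume "z \<notin> coupled_chain_spectrum h \<theta> b \<omega>\<^sub>1 \<omega>\<^sub>2"
    then obtain \<gamma> where \<gamma>: "\<gamma> > 0" and
      below: "\<And>f. \<gamma> * norm f \<le> norm (kernel_shift (chain_kernel h \<theta> b \<omega>\<^sub>1 \<omega>\<^sub>2) z f)"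
      unfolding not_in_coupled_chain_spectrum_iff[OF even M] by blast
    have below_K: "\<gamma> * norm f \<le> norm (kernel_shift (K N) z f)" for N f
    proof -
      have "bij (map_sum (\<lambda>n. n + k N) (\<lambda>n. n + l N))"
        by (rule bij_betw_byWitness[where f' = "map_sum (\<lambda>n. n - k N) (\<lambda>n. n - l N)"])
          (auto simp: sum.map_comp o_def sum.map_ident)
      from kernel_shift_reindex_bounded_below[OF this M below, of f]
      show ?thesis by (simp add: chain_kernel_translate K_def \<beta>_def)
    qed
    have lim_K: "(\<lambda>N. norm (kernel_shift (K N) z f)) \<longlonglongrightarrow>
        norm (kernel_shift (chain_kernel h \<theta> b' \<omega>\<^sub>1' \<omega>\<^sub>2') z f)" for f
      unfolding kernel_shift_def by (intro tendsto_intros kernel_l2_tendsto[OF lim bound MD])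
    have "\<gamma> * norm f \<le> norm (kernel_shift (chain_kernel h \<theta> b' \<omega>\<^sub>1' \<omega>\<^sub>2') z f)" for f
      by (rule LIMSEQ_le_const[OF lim_K]) (use below_K in blast)
    then have "z \<notin> coupled_chain_spectrum h \<theta> b' \<omega>\<^sub>1' \<omega>\<^sub>2'"
      unfolding not_in_coupled_chain_spectrum_iff[OF even M'] using \<gamma> by blast
    then show False using z by contradiction
  qed
qed

section \<open>Recurrence of patterns\<close>

text \<open>The predicate may fail to be measurable, so the argument goes through a null superset of
  the exceptional set times the whole second space.\<close>

lemma AE_pair_fst:
  assumes N: "sigma_finite_measure N" and "AE x in M. P x"
  shows "AE x in M \<Otimes>\<^sub>M N. P (fst x)"
proof -
  obtain A where A: "{x \<in> space M. \<not> P x} \<subseteq> A" "A \<in> null_sets M"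
    using assms(2) unfolding eventually_ae_filter by blast
  show ?thesis
    using sigma_finite_measure.times_in_null_sets1[OF N A(2), of "space N"] A(1)
    unfolding eventually_ae_filter by (intro bexI[of _ "A \<times> space N"]) (auto simp: space_pair_measure)
qed

lemma AE_pair_snd:
  assumes N: "sigma_finite_measure N" and "AE x in N. P x"
  shows "AE x in M \<Otimes>\<^sub>M N. P (snd x)"
proof -
  obtain A where A: "{x \<in> space N. \<not> P x} \<subseteq> A" "A \<in> null_sets N"
    using assms(2) unfolding eventually_ae_filter by blast
  show ?thesis
    using sigma_finite_measure.times_in_null_sets2[OF N _ A(2), of "space M" M] A(1)
    unfolding eventually_ae_filter by (intro bexI[of _ "space M \<times> A"]) (auto simp: space_pair_measure)
qed

lemma infinite_int_unbounded:
  fixes I :: "int set"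
  assumes "infinite I"
  shows "\<exists>k\<in>I. n < \<bar>k\<bar>"
proof (rule ccontr)
  assume "\<not> ?thesis"
  then have "I \<subseteq> {- n..n}" by (force simp: not_less)
  then show False using assms finite_subset by blast
qed

lemma finite_int_bounded:
  fixes W :: "int set"
  assumes "finite W"
  shows "\<exists>D. \<forall>j\<in>W. \<bar>j\<bar> \<le> D"
  using member_le_sum[of _ W abs] assms by (intro exI[of _ "\<Sum>j\<in>W. \<bar>j\<bar>"]) auto

text \<open>Serves to choose translates of a finite window that are pairwise disjoint and hence
  carry independent data.\<close>

lemma infinite_int_spaced:
  fixes I :: "int set"
  assumes I: "infinite I" and d: "0 \<le> d"
  shows "\<exists>f :: nat \<Rightarrow> int. (\<forall>i. f i \<in> I) \<and> (\<forall>i j. i < j \<longrightarrow> \<bar>f i\<bar> + d < \<bar>f j\<bar>)"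
proof -
  have "\<exists>f. \<forall>i. f i \<in> I \<and> \<bar>f i\<bar> + d < \<bar>f (Suc i)\<bar>"
    using infinite_int_unbounded[OF I] by (intro dependent_nat_choice[where P = "\<lambda>_ x. x \<in> I"]) blast+
  then obtain f where f: "\<And>i. f i \<in> I" "\<And>i. \<bar>f i\<bar> + d < \<bar>f (Suc i)\<bar>" by blast
  have "\<bar>f i\<bar> + d < \<bar>f j\<bar>" if "i < j" for i j
    using that
  proof (induction rule: less_Suc_induct)
    case (1 i) show ?case by (rule f)
  next
    case (2 i j k) then show ?case using d by linarith
  qed
  with f(1) show ?thesis by blast
qed

text \<open>Independence is read off from the joint law: the coordinates together form the identity
  map, whose law is the product measure itself.\<close>

lemma indep_vars_PiM_components:
  fixes M :: "'i \<Rightarrow> 'a measure"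
  assumes "I \<noteq> {}" and M: "\<And>i. prob_space (M i)"
  shows "prob_space.indep_vars (PiM I M) M (\<lambda>i x. x i) I"
proof -
  interpret product_prob_space M I
    by (intro product_prob_spaceI M)
  have "distr (PiM I M) (PiM I M) (\<lambda>x. \<lambda>i\<in>I. x i) = distr (PiM I M) (PiM I M) (\<lambda>x. x)"
    by (intro distr_cong) (auto simp: space_PiM PiE_def extensional_restrict)
  also have "\<dots> = (\<Pi>\<^sub>M i\<in>I. distr (PiM I M) (M i) (\<lambda>x. x i))"
    by (auto simp: distr_id2 PiM_component intro!: PiM_cong)
  finally show ?thesis
    using assms(1) by (subst indep_vars_iff_distr_eq_PiM') auto
qed

text \<open>Along a sparse sequence in \<open>I\<close> the translated windows are disjoint.
  Failures there are independent and share the probability \<open>1 - p < 1\<close>, so almost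
  surely not all of them happen.\<close>

lemma AE_pattern_occurs:
  fixes P :: "'a measure" and A :: "int \<Rightarrow> 'a set"
  assumes P: "prob_space P" and I: "infinite I" and W: "finite W"
    and A: "\<And>j. j \<in> W \<Longrightarrow> A j \<in> sets P" and pos: "\<And>j. j \<in> W \<Longrightarrow> 0 < measure P (A j)"
  shows "AE \<omega> in (\<Pi>\<^sub>M j\<in>(UNIV :: int set). P). \<exists>k\<in>I. \<forall>j\<in>W. \<omega> (j + k) \<in> A j"
proof -
  let ?M = "\<Pi>\<^sub>M j\<in>(UNIV :: int set). P"
  interpret product_prob_space "\<lambda>_ :: int. P" UNIV
    by (intro product_prob_spaceI P)
  obtain D where D: "\<And>j. j \<in> W \<Longrightarrow> \<bar>j\<bar> \<le> D"
    using finite_int_bounded[OF W] by blast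
  \<comment> \<open>A coincidence \<open>u + f i = v + f j\<close> with \<open>u\<close>,
    \<open>v\<close> in \<open>W\<close> would force
    \<open>\<bar>f j\<bar> \<le> \<bar>f i\<bar> + 2 * L\<close>, against the spacing. The maximum
    with \<open>0\<close> is there because \<open>D\<close> may be negative when \<open>W\<close> is
    empty.\<close>
  define L where "L = max 0 D"
  obtain f :: "nat \<Rightarrow> int" where f: "\<And>i. f i \<in> I" "\<And>i j. i < j \<Longrightarrow> \<bar>f i\<bar> + 2 * L < \<bar>f j\<bar>"
    using infinite_int_spaced[OF I, of "2 * L"] by (auto simp: L_def)
  define K where "K i = (\<lambda>j. j + f i) ` W" for i
  have disj: "disjoint_family_on K UNIV"
  proof -
    have "K i \<inter> K j = {}" if "i < j" for i j
    proof -
      have "u + f i \<noteq> v + f j" if "u \<in> W" "v \<in> W" for u v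
        using f(2)[OF \<open>i < j\<close>] D[OF that(1)] D[OF that(2)] by (auto simp: L_def)
      then show ?thesis by (auto simp: K_def)
    qed
    then show ?thesis unfolding disjoint_family_on_def by (metis Int_commute linorder_neqE_nat)
  qed
  have indep: "indep_vars (\<lambda>i. PiM (K i) (\<lambda>_. P)) (\<lambda>i \<omega>. restrict (\<lambda>j. \<omega> j) (K i)) UNIV"
    by (intro indep_vars_restrict[OF indep_vars_PiM_components] disj) (auto intro: assms(1))
  \<comment> \<open>Failure is phrased on the factor over \<open>K i\<close> alone, so that
    \<open>E i\<close> is a preimage under the restriction to \<open>K i\<close>, as independence
    demands.\<close>
  define B where "B i = {x \<in> space (PiM (K i) (\<lambda>_. P)). \<not> (\<forall>j\<in>W. x (j + f i) \<in> A j)}" for i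
  have B: "B i \<in> sets (PiM (K i) (\<lambda>_. P))" for i
  proof -
    have "{x \<in> space (PiM (K i) (\<lambda>_. P)). x (j + f i) \<in> A j} \<in> sets (PiM (K i) (\<lambda>_. P))" if "j \<in> W" for j
      using that A by (intro measurable_sets_Collect[OF measurable_component_singleton] ) (auto simp: K_def)
    then show ?thesis
      unfolding B_def using W by (intro sets.sets_Collect_neg sets.sets_Collect_finite_All) auto
  qed
  define E where "E i = (\<lambda>\<omega>. restrict (\<lambda>j. \<omega> j) (K i)) -` B i \<inter> space ?M" for i
  have E_eq: "E i = {\<omega> \<in> space ?M. \<not> (\<forall>j\<in>W. \<omega> (j + f i) \<in> A j)}" for i
  proof -
    have "restrict (\<lambda>j. \<omega> j) (K i) \<in> space (PiM (K i) (\<lambda>_. P))" if "\<omega> \<in> space ?M" for \<omega>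
      using that by (auto simp: space_PiM)
    moreover have "j + f i \<in> K i" if "j \<in> W" for j using that by (auto simp: K_def)
    ultimately show ?thesis by (auto simp: E_def B_def)
  qed
  define p where "p = (\<Prod>j\<in>W. measure P (A j))"
  have p: "0 < p" unfolding p_def using pos by (intro prod_pos) auto
  have prob_occurs: "{\<omega> \<in> space ?M. \<forall>j\<in>W. \<omega> (j + f i) \<in> A j} \<in> sets ?M"
    "measure ?M {\<omega> \<in> space ?M. \<forall>j\<in>W. \<omega> (j + f i) \<in> A j} = p" for i
  proof -
    have eq: "{\<omega> \<in> space ?M. \<forall>j\<in>W. \<omega> (j + f i) \<in> A j} = {\<omega> \<in> space ?M. \<forall>s\<in>K i. \<omega> s \<in> A (s - f i)}"
      by (auto simp: K_def)
    have inj: "inj_on (\<lambda>j. j + f i) W" by (auto simp: inj_on_def)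
    have "emeasure ?M {\<omega> \<in> space ?M. \<forall>s\<in>K i. \<omega> s \<in> A (s - f i)} = (\<Prod>s\<in>K i. emeasure P (A (s - f i)))"
      using W A by (intro emeasure_PiM_Collect) (auto simp: K_def)
    also have "\<dots> = (\<Prod>j\<in>W. emeasure P (A j))"
      unfolding K_def by (subst prod.reindex[OF inj]) (simp add: o_def)
    also have "\<dots> = ennreal p"
      unfolding p_def M.emeasure_eq_measure by (rule prod_ennreal) simp
    finally show "measure ?M {\<omega> \<in> space ?M. \<forall>j\<in>W. \<omega> (j + f i) \<in> A j} = p"
      unfolding eq using p by (simp add: measure_def)
    show "{\<omega> \<in> space ?M. \<forall>j\<in>W. \<omega> (j + f i) \<in> A j} \<in> sets ?M"
      using W A
      by (intro sets.sets_Collect_finite_All measurable_sets_Collect[OF measurable_component_singleton]) auto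
  qed
  have E_sets: "E i \<in> events" for i
    unfolding E_eq by (intro sets.sets_Collect_neg prob_occurs)
  have prob_E: "prob (E i) = 1 - p" for i
  proof -
    have "E i = space ?M - {\<omega> \<in> space ?M. \<forall>j\<in>W. \<omega> (j + f i) \<in> A j}"
      unfolding E_eq by blast
    then show ?thesis
      using prob_compl[OF prob_occurs(1)[of i]] prob_occurs(2)[of i] by simp
  qed
  have "prob (\<Inter>i. E i) \<le> (1 - p) ^ Suc N" for N
  proof -
    have "prob (\<Inter>i. E i) \<le> prob (\<Inter>i\<in>{..N}. E i)"
      using E_sets by (intro finite_measure_mono) auto
    also have "\<dots> = (\<Prod>i\<in>{..N}. prob (E i))"
      unfolding E_def by (intro indep_varsD[OF indep] B) auto
    also have "\<dots> = (1 - p) ^ Suc N" by (simp add: prob_E)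
    finally show ?thesis .
  qed
  moreover have "(\<lambda>N. (1 - p) ^ Suc N) \<longlonglongrightarrow> 0"
    using p prob_E[of 0] measure_nonneg[of ?M "E 0"] by (intro LIMSEQ_Suc LIMSEQ_realpow_zero) auto
  ultimately have "prob (\<Inter>i. E i) \<le> 0"
    by (intro LIMSEQ_le_const) auto
  then have "emeasure ?M (\<Inter>i. E i) = 0"
    by (simp add: emeasure_eq_measure measure_le_0_iff)
  then have "(\<Inter>i. E i) \<in> null_sets ?M"
    using E_sets by (intro null_setsI) auto
  then show ?thesis
    by (rule AE_I') (use f(1) in \<open>auto simp: E_eq\<close>)
qed

text \<open>Removing a finite interval from \<open>I\<close> leaves an infinite set, in which the
  pattern still occurs; countably many intervals exhaust the integers.\<close>

lemma AE_pattern_infinitely_often: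
  fixes P :: "'a measure" and A :: "int \<Rightarrow> 'a set"
  assumes P: "prob_space P" and I: "infinite I" and W: "finite W"
    and A: "\<And>j. j \<in> W \<Longrightarrow> A j \<in> sets P" and pos: "\<And>j. j \<in> W \<Longrightarrow> 0 < measure P (A j)"
  shows "AE \<omega> in (\<Pi>\<^sub>M j\<in>(UNIV :: int set). P). infinite {k\<in>I. \<forall>j\<in>W. \<omega> (j + k) \<in> A j}"
proof -
  have "AE \<omega> in (\<Pi>\<^sub>M j\<in>(UNIV :: int set). P). \<forall>n::nat. \<exists>k\<in>I - {- int n..int n}. \<forall>j\<in>W. \<omega> (j + k) \<in> A j"
    unfolding AE_all_countable
    by (intro allI AE_pattern_occurs[OF P _ W A pos]) (use I in auto)
  then show ?thesis
  proof eventually_elim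
    case (elim \<omega>)
    show ?case
    proof
      assume "finite {k\<in>I. \<forall>j\<in>W. \<omega> (j + k) \<in> A j}"
      from finite_int_bounded[OF this] obtain D where D: "\<And>k. k \<in> {k\<in>I. \<forall>j\<in>W. \<omega> (j + k) \<in> A j} \<Longrightarrow> \<bar>k\<bar> \<le> D"
        by blast
      from elim[rule_format, of "nat D"] obtain k where
        "k \<in> I" "\<forall>j\<in>W. \<omega> (j + k) \<in> A j" "k \<notin> {- int (nat D)..int (nat D)}" by blast
      with D[of k] show False by (auto split: if_splits)
    qed
  qed
qed

lemma AE_pattern_pair_occurs:
  fixes P :: "'a measure" and A\<^sub>1 A\<^sub>2 :: "int \<Rightarrow> 'a set" and G :: "(int \<times> int) set"
  assumes P: "prob_space P" and W: "finite W" and G: "infinite G"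
    and fibres: "\<And>k. finite {l. (k, l) \<in> G}" "\<And>l. finite {k. (k, l) \<in> G}"
    and A: "\<And>j. j \<in> W \<Longrightarrow> A\<^sub>1 j \<in> sets P" "\<And>j. j \<in> W \<Longrightarrow> A\<^sub>2 j \<in> sets P"
    and pos: "\<And>j. j \<in> W \<Longrightarrow> 0 < measure P (A\<^sub>1 j)" "\<And>j. j \<in> W \<Longrightarrow> 0 < measure P (A\<^sub>2 j)"
  shows "AE \<omega> in (\<Pi>\<^sub>M j\<in>(UNIV :: int set). P) \<Otimes>\<^sub>M (\<Pi>\<^sub>M j\<in>(UNIV :: int set). P).
    \<exists>k l. (k, l) \<in> G \<and> (\<forall>j\<in>W. fst \<omega> (j + k) \<in> A\<^sub>1 j) \<and> (\<forall>j\<in>W. snd \<omega> (j + l) \<in> A\<^sub>2 j)"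
proof -
  let ?M = "\<Pi>\<^sub>M j\<in>(UNIV :: int set). P"
  interpret M: prob_space ?M by (intro prob_space_PiM P)
  interpret pair_sigma_finite ?M ?M ..
  \<comment> \<open>\<open>H\<close> is covered by the fibres of \<open>G\<close> over its
    projection, and these are finite; a finite projection would make \<open>H\<close>
    finite.\<close>
  have infinite_proj: "infinite (fst ` H)" "infinite (snd ` H)" if "H \<subseteq> G" "infinite H" for H
  proof -
    have sub_fst: "H \<subseteq> (\<Union>k\<in>fst ` H. Pair k ` {l. (k, l) \<in> G})"
      using that(1) by force
    have fin_fst: "finite (\<Union>k\<in>fst ` H. Pair k ` {l. (k, l) \<in> G})" if "finite (fst ` H)"
      by (intro finite_UN_I[OF that] finite_imageI fibres)
    show "infinite (fst ` H)" using finite_subset[OF sub_fst fin_fst] that(2) by blast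
    have sub_snd: "H \<subseteq> (\<Union>l\<in>snd ` H. (\<lambda>k. (k, l)) ` {k. (k, l) \<in> G})"
      using that(1) by force
    have fin_snd: "finite (\<Union>l\<in>snd ` H. (\<lambda>k. (k, l)) ` {k. (k, l) \<in> G})" if "finite (snd ` H)"
      by (intro finite_UN_I[OF that] finite_imageI fibres)
    show "infinite (snd ` H)" using finite_subset[OF sub_snd fin_snd] that(2) by blast
  qed
  have ev: "{\<omega> \<in> space ?M. \<forall>j\<in>W. \<omega> (j + k) \<in> A j} \<in> sets ?M" if "\<And>j. j \<in> W \<Longrightarrow> A j \<in> sets P" for A k
    using W that
    by (intro sets.sets_Collect_finite_All measurable_sets_Collect[OF measurable_component_singleton]) auto
  show ?thesis
  proof (rule AE_pair_measure)
    show "{\<omega> \<in> space (?M \<Otimes>\<^sub>M ?M). \<exists>k l. (k, l) \<in> G \<and> (\<forall>j\<in>W. fst \<omega> (j + k) \<in> A\<^sub>1 j) \<and> (\<forall>j\<in>W. snd \<omega> (j + l) \<in> A\<^sub>2 j)}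
        \<in> sets (?M \<Otimes>\<^sub>M ?M)"
      by (intro sets.sets_Collect_countable_Ex sets.sets_Collect_conj sets.sets_Collect_const
          measurable_sets_Collect[OF measurable_fst ev] measurable_sets_Collect[OF measurable_snd ev] A)
    have "AE \<omega>\<^sub>1 in ?M. infinite {k \<in> fst ` G. \<forall>j\<in>W. \<omega>\<^sub>1 (j + k) \<in> A\<^sub>1 j}"
      by (intro AE_pattern_infinitely_often P W A pos infinite_proj G) auto
    then show "AE \<omega>\<^sub>1 in ?M. AE \<omega>\<^sub>2 in ?M.
        \<exists>k l. (k, l) \<in> G \<and> (\<forall>j\<in>W. fst (\<omega>\<^sub>1, \<omega>\<^sub>2) (j + k) \<in> A\<^sub>1 j) \<and> (\<forall>j\<in>W. snd (\<omega>\<^sub>1, \<omega>\<^sub>2) (j + l) \<in> A\<^sub>2 j)"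
    proof eventually_elim
      case (elim \<omega>\<^sub>1)
      \<comment> \<open>With \<open>\<omega>\<^sub>1\<close> fixed, \<open>H\<close> holds the pairs
        whose first entry already suits the first chain. Its second projection is the infinite set
        from which the second chain may still choose.\<close>
      define H where "H = {(k, l) \<in> G. \<forall>j\<in>W. \<omega>\<^sub>1 (j + k) \<in> A\<^sub>1 j}"
      have "{k \<in> fst ` G. \<forall>j\<in>W. \<omega>\<^sub>1 (j + k) \<in> A\<^sub>1 j} \<subseteq> fst ` H"
        by (force simp: H_def)
      then have "infinite H" using elim by (meson finite_imageI finite_subset)
      then have "infinite (snd ` H)" by (intro infinite_proj) (auto simp: H_def)
      then have "AE \<omega>\<^sub>2 in ?M. \<exists>l\<in>snd ` H. \<forall>j\<in>W. \<omega>\<^sub>2 (j + l) \<in> A\<^sub>2 j"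
        by (intro AE_pattern_occurs P W A pos) auto
      then show ?case by eventually_elim (force simp: H_def)
    qed
  qed
qed

text \<open>Finitely many pairs would give finitely many values, but the values are dense and one
  more falls into the interval. In a fibre, the inequality bounds the free integer in terms of the
  fixed one.\<close>

lemma irrational_approx_pairs:
  fixes a \<beta> \<epsilon> :: real
  assumes a: "0 < a" "a \<notin> \<rat>" and \<epsilon>: "0 < \<epsilon>"
  defines "G \<equiv> {(k :: int, l :: int). \<bar>of_int k - a * of_int l - \<beta>\<bar> < \<epsilon>}"
  shows "infinite G" and "finite {l. (k, l) \<in> G}" and "finite {k. (k, l) \<in> G}"
proof -
  show "infinite G"
  proof
    assume fin: "finite G"
    define V where "V = (\<lambda>(k, l). of_int k - a * of_int l) ` G"
    have "finite V" unfolding V_def by (intro finite_imageI fin)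
    moreover have "infinite {\<beta> - \<epsilon><..<\<beta> + \<epsilon>}" using \<epsilon> by simp
    ultimately have "\<not> {\<beta> - \<epsilon><..<\<beta> + \<epsilon>} \<subseteq> V" using finite_subset by blast
    then obtain \<alpha> where \<alpha>: "\<alpha> \<in> {\<beta> - \<epsilon><..<\<beta> + \<epsilon>} - V" by blast
    have "open ({\<beta> - \<epsilon><..<\<beta> + \<epsilon>} - V)"
      using \<open>finite V\<close> by (intro open_Diff finite_imp_closed) auto
    with \<alpha> obtain \<delta> where \<delta>: "\<delta> > 0" "ball \<alpha> \<delta> \<subseteq> {\<beta> - \<epsilon><..<\<beta> + \<epsilon>} - V"
      by (meson openE)
    obtain h k :: int where "\<bar>of_int k * a - of_int h - \<alpha>\<bar> < \<delta>"
      using sequence_of_fractional_parts_is_dense[OF a(2) \<delta>(1)] by metis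
    \<comment> \<open>Density is stated for \<open>of_int k * a - of_int h\<close>, hence the pair
      \<open>(- h, - k)\<close>.\<close>
    then have "of_int (- h) - a * of_int (- k) \<in> ball \<alpha> \<delta>"
      by (simp add: dist_real_def abs_minus_commute algebra_simps)
    then have *: "of_int (- h) - a * of_int (- k) \<in> {\<beta> - \<epsilon><..<\<beta> + \<epsilon>} - V" using \<delta>(2) by blast
    then have "(- h, - k) \<in> G" by (simp add: G_def abs_less_iff algebra_simps)
    then have "of_int (- h) - a * of_int (- k) \<in> V" unfolding V_def by force
    with * show False by blast
  qed
  define N where "N = \<lceil>(\<bar>of_int k\<bar> + \<bar>\<beta>\<bar> + \<epsilon>) / a\<rceil>"
  have "\<bar>l\<bar> \<le> N" if "(k, l) \<in> G" for l
  proof -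
    have "a * \<bar>of_int l\<bar> = \<bar>a * of_int l\<bar>" using a by (simp add: abs_mult)
    also have "\<dots> \<le> \<bar>of_int k\<bar> + \<bar>\<beta>\<bar> + \<epsilon>" using that by (simp add: G_def)
    finally have "of_int \<bar>l\<bar> \<le> (\<bar>of_int k\<bar> + \<bar>\<beta>\<bar> + \<epsilon>) / a" using a by (simp add: field_simps)
    then show ?thesis unfolding N_def by linarith
  qed
  then have "{l. (k, l) \<in> G} \<subseteq> {- N..N}" by (force simp: abs_le_iff)
  then show "finite {l. (k, l) \<in> G}" by (rule finite_subset) simp
  define N' where "N' = \<lceil>\<bar>a * of_int l\<bar> + \<bar>\<beta>\<bar> + \<epsilon>\<rceil>"
  have "\<bar>k\<bar> \<le> N'" if "(k, l) \<in> G" for k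
  proof -
    have "of_int \<bar>k\<bar> \<le> \<bar>a * of_int l\<bar> + \<bar>\<beta>\<bar> + \<epsilon>" using that by (simp add: G_def)
    then show ?thesis unfolding N'_def by linarith
  qed
  then have "{k. (k, l) \<in> G} \<subseteq> {- N'..N'}" by (force simp: abs_le_iff)
  then show "finite {k. (k, l) \<in> G}" by (rule finite_subset) simp
qed

text \<open>A pattern on the window \<open>{- L..L}\<close> is a list of \<open>2 L + 1\<close> rationals; rational lists keep the
  set of all patterns countable.\<close>

definition pattern_at :: "nat \<Rightarrow> rat list \<Rightarrow> int \<Rightarrow> real" where
  "pattern_at L rs j = of_rat (rs ! nat (j + int L))"

definition admissible :: "real measure \<Rightarrow> nat \<Rightarrow> rat list \<Rightarrow> bool" where
  "admissible P L rs \<longleftrightarrow> (\<forall>j\<in>{- int L..int L}. 0 < measure P (ball (pattern_at L rs j) (1 / Suc L)))"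

definition occurs_at :: "nat \<Rightarrow> rat list \<Rightarrow> (int \<Rightarrow> real) \<Rightarrow> int \<Rightarrow> bool" where
  "occurs_at L rs \<omega> k \<longleftrightarrow> (\<forall>j\<in>{- int L..int L}. \<omega> (j + k) \<in> ball (pattern_at L rs j) (1 / Suc L))"

text \<open>Apart from the bound \<open>R\<close>, this says that \<open>x\<close> lies in the
  topological support of \<open>P\<close>: balls with rational centres and radii
  \<open>1 / Suc N\<close> form a countable base, which is what makes it an almost sure
  property.\<close>

definition typical_site :: "real measure \<Rightarrow> real \<Rightarrow> real \<Rightarrow> bool" where
  "typical_site P R x \<longleftrightarrow> \<bar>x\<bar> \<le> R \<and> (\<forall>(q::rat) N. x \<in> ball (of_rat q) (1 / Suc N) \<longrightarrow> 0 < measure P (ball (of_rat q) (1 / Suc N)))"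

text \<open>The quantifiers range over countable types, so the conditions hold together off a single
  null set. \<open>L\<close> sets window and tolerance at once, and the target
  \<open>\<beta>\<close> later stands for a difference \<open>b - b'\<close>.\<close>

definition recurrent :: "real measure \<Rightarrow> real \<Rightarrow> (int \<Rightarrow> real) \<times> (int \<Rightarrow> real) \<Rightarrow> bool" where
  "recurrent P a \<omega> \<longleftrightarrow> (\<forall>L (\<beta>::rat) rs rs'. admissible P L rs \<longrightarrow> admissible P L rs' \<longrightarrow>
     (\<exists>k l. \<bar>of_int k - a * of_int l - of_rat \<beta>\<bar> < 1 / Suc L \<and> occurs_at L rs (fst \<omega>) k \<and> occurs_at L rs' (snd \<omega>) l))"

lemma AE_typical_site:
  assumes P: "prob_space P" "sets P = sets borel" and K: "emeasure P (- K) = 0" "compact K"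
    and R: "\<And>x. x \<in> K \<Longrightarrow> \<bar>x\<bar> \<le> R"
  shows "AE x in P. typical_site P R x"
proof -
  interpret prob_space P by (rule P)
  have "- K \<in> null_sets P"
    using K compact_imp_closed[OF K(2)] by (intro null_setsI) (auto simp: P(2))
  then have "AE x in P. \<bar>x\<bar> \<le> R"
    by (rule AE_I') (use R in force)
  \<comment> \<open>A ball of measure zero is almost surely avoided; for any other ball the
    implication holds everywhere.\<close>
  moreover have "AE x in P. x \<in> ball (of_rat q) (1 / Suc N) \<longrightarrow> 0 < measure P (ball (of_rat q) (1 / Suc N))"
    for q :: rat and N
  proof (cases "measure P (ball (of_rat q) (1 / Suc N)) = 0")
    case True
    then have "ball (of_rat q) (1 / Suc N) \<in> null_sets P"
      by (intro null_setsI) (auto simp: emeasure_eq_measure P(2))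
    then show ?thesis by (rule AE_I') auto
  qed (simp add: zero_less_measure_iff)
  ultimately show ?thesis
    unfolding typical_site_def by (simp add: AE_all_countable)
qed

lemma AE_recurrent:
  assumes P: "prob_space P" "sets P = sets borel" and a: "0 < a" "a \<notin> \<rat>"
  shows "AE \<omega> in (\<Pi>\<^sub>M j\<in>(UNIV :: int set). P) \<Otimes>\<^sub>M (\<Pi>\<^sub>M j\<in>(UNIV :: int set). P). recurrent P a \<omega>"
  unfolding recurrent_def AE_all_countable
proof (intro allI)
  fix L and \<beta> :: rat and rs rs' :: "rat list"
  show "AE \<omega> in (\<Pi>\<^sub>M j\<in>(UNIV :: int set). P) \<Otimes>\<^sub>M (\<Pi>\<^sub>M j\<in>(UNIV :: int set). P).
    admissible P L rs \<longrightarrow> admissible P L rs' \<longrightarrow>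
     (\<exists>k l. \<bar>of_int k - a * of_int l - of_rat \<beta>\<bar> < 1 / Suc L \<and> occurs_at L rs (fst \<omega>) k \<and> occurs_at L rs' (snd \<omega>) l)"
  proof (cases "admissible P L rs \<and> admissible P L rs'")
    case True
    define G where "G = {(k :: int, l :: int). \<bar>of_int k - a * of_int l - of_rat \<beta>\<bar> < 1 / Suc L}"
    note G = irrational_approx_pairs[OF a, where \<epsilon> = "1 / real (Suc L)" and \<beta> = "real_of_rat \<beta>", folded G_def]
    have "AE \<omega> in (\<Pi>\<^sub>M j\<in>(UNIV :: int set). P) \<Otimes>\<^sub>M (\<Pi>\<^sub>M j\<in>(UNIV :: int set). P).
      \<exists>k l. (k, l) \<in> G \<and> (\<forall>j\<in>{- int L..int L}. fst \<omega> (j + k) \<in> ball (pattern_at L rs j) (1 / Suc L)) \<and>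
        (\<forall>j\<in>{- int L..int L}. snd \<omega> (j + l) \<in> ball (pattern_at L rs' j) (1 / Suc L))"
      using True by (intro AE_pattern_pair_occurs P(1) G) (auto simp: P(2) admissible_def)
    then show ?thesis
      by eventually_elim (simp add: G_def occurs_at_def)
  qed auto
qed

lemma ex_rat_near: "0 < e \<Longrightarrow> \<exists>q::rat. \<bar>x - of_rat q\<bar> < e" for x e :: real
  using of_rat_dense[of "x - e" "x + e"] by (auto simp: abs_less_iff algebra_simps)

lemma recurrent_approximates:
  assumes rec: "recurrent P a \<omega>" and site: "\<And>j. typical_site P R (fst \<omega>' j)" "\<And>j. typical_site P R (snd \<omega>' j)"
  shows "\<exists>k l. \<bar>b - of_int k + a * of_int l - b'\<bar> < 1 / Suc N \<and>
      (\<forall>j. \<bar>j\<bar> \<le> int N \<longrightarrow> \<bar>fst \<omega> (j + k) - fst \<omega>' j\<bar> < 1 / Suc N \<and> \<bar>snd \<omega> (j + l) - snd \<omega>' j\<bar> < 1 / Suc N)"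
proof -
  \<comment> \<open>Since \<open>Suc L = 2 * Suc N\<close>, two errors below
    \<open>1 / Suc L\<close>, one from rational approximation and one from recurrence, add up to
    less than \<open>1 / Suc N\<close>. The larger window also contains
    \<open>{- N..N}\<close>.\<close>
  define L where "L = 2 * N + 1"
  have half: "1 / real (Suc L) + 1 / real (Suc L) = 1 / real (Suc N)"
    by (simp add: L_def field_simps)
  have pattern: "\<exists>rs. \<forall>j\<in>{- int L..int L}. \<bar>u j - pattern_at L rs j\<bar> < 1 / Suc L" for u
  proof -
    have "\<exists>r::int \<Rightarrow> rat. \<forall>j. \<bar>u j - of_rat (r j)\<bar> < 1 / Suc L"
      by (intro choice allI ex_rat_near) simp
    then obtain r :: "int \<Rightarrow> rat" where r: "\<And>j. \<bar>u j - of_rat (r j)\<bar> < 1 / Suc L" by blast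
    \<comment> \<open>List position \<open>i\<close> stores site \<open>i - L\<close>, undoing the
      index shift in \<open>pattern_at\<close>.\<close>
    let ?rs = "map (\<lambda>i. r (int i - int L)) [0..<2 * L + 1]"
    have "\<forall>j\<in>{- int L..int L}. pattern_at L ?rs j = of_rat (r j)"
    proof
      fix j assume "j \<in> {- int L..int L}"
      then have "nat (j + int L) < 2 * L + 1" "int (nat (j + int L)) = j + int L" by auto
      then show "pattern_at L ?rs j = of_rat (r j)"
        by (simp add: pattern_at_def del: upt_Suc)
    qed
    then show ?thesis using r by (intro exI[of _ ?rs]) auto
  qed
  obtain rs rs' where rs: "\<And>j. j \<in> {- int L..int L} \<Longrightarrow> \<bar>fst \<omega>' j - pattern_at L rs j\<bar> < 1 / Suc L"
    and rs': "\<And>j. j \<in> {- int L..int L} \<Longrightarrow> \<bar>snd \<omega>' j - pattern_at L rs' j\<bar> < 1 / Suc L"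
    using pattern[of "fst \<omega>'"] pattern[of "snd \<omega>'"] by blast
  \<comment> \<open>If \<open>k - a l\<close> is close to \<open>\<beta>\<close>, hence to
    \<open>b - b'\<close>, then \<open>b - k + a l\<close> is close to \<open>b'\<close>.\<close>
  obtain \<beta> :: rat where \<beta>: "\<bar>b - b' - of_rat \<beta>\<bar> < 1 / Suc L"
    using ex_rat_near[of "1 / Suc L" "b - b'"] by auto
  \<comment> \<open>A typical site lies in the ball around its own rational approximation, so that
    ball has positive measure.\<close>
  have admissible: "admissible P L qs"
    if "\<And>j. typical_site P R (u j)" "\<And>j. j \<in> {- int L..int L} \<Longrightarrow> \<bar>u j - pattern_at L qs j\<bar> < 1 / Suc L" for u qs
    unfolding admissible_def
  proof
    fix j assume "j \<in> {- int L..int L}"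
    then have "u j \<in> ball (pattern_at L qs j) (1 / Suc L)"
      using that(2)[of j] by (simp add: dist_real_def abs_minus_commute)
    then show "0 < measure P (ball (pattern_at L qs j) (1 / Suc L))"
      using that(1)[of j] unfolding typical_site_def pattern_at_def by blast
  qed
  have "admissible P L rs" "admissible P L rs'"
    using admissible[OF site(1) rs] admissible[OF site(2) rs'] by blast+
  then obtain k l where kl: "\<bar>of_int k - a * of_int l - of_rat \<beta>\<bar> < 1 / Suc L"
    "occurs_at L rs (fst \<omega>) k" "occurs_at L rs' (snd \<omega>) l"
    using rec unfolding recurrent_def by blast
  have "\<bar>fst \<omega> (j + k) - fst \<omega>' j\<bar> < 1 / Suc N \<and> \<bar>snd \<omega> (j + l) - snd \<omega>' j\<bar> < 1 / Suc N"
    if "\<bar>j\<bar> \<le> int N" for j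
  proof -
    have j: "j \<in> {- int L..int L}" using that by (auto simp: L_def)
    have "\<bar>fst \<omega> (j + k) - pattern_at L rs j\<bar> < 1 / Suc L" "\<bar>snd \<omega> (j + l) - pattern_at L rs' j\<bar> < 1 / Suc L"
      using kl(2,3) j by (auto simp: occurs_at_def dist_real_def abs_minus_commute)
    then show ?thesis using rs[OF j] rs'[OF j] half by linarith
  qed
  moreover have "\<bar>b - of_int k + a * of_int l - b'\<bar> < 1 / Suc N"
    using kl(1) \<beta> half by linarith
  ultimately show ?thesis by blast
qed

section \<open>Almost sure constancy of the spectrum\<close>

theorem theorem3p23:
  fixes \<theta> :: real and h :: "real \<Rightarrow> real" and P\<^sub>0 :: "real measure"
  assumes "0 < \<theta>" and "\<theta> < 1" and "\<theta> \<notin> \<rat>"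
    and "even_function h" and "smooth_function h" and "exponentially_decaying h"
    and "prob_space P\<^sub>0" and "sets P\<^sub>0 = sets borel" and "compactly_supported P\<^sub>0"
  shows "\<exists>S :: real set.
    - {(b, \<omega>\<^sub>1, \<omega>\<^sub>2). coupled_chain_spectrum h \<theta> b \<omega>\<^sub>1 \<omega>\<^sub>2 = complex_of_real ` S}
      \<in> null_sets (parameter_measure P\<^sub>0)"
proof -
  let ?M = "site_product P\<^sub>0"
  interpret M: prob_space ?M
    unfolding site_product_def by (intro prob_space_PiM assms)
  interpret MM: pair_prob_space ?M ?M ..
  have a: "0 < 1 - \<theta>" "1 - \<theta> \<notin> \<rat>"
    using assms(2,3) Rats_diff[of 1 "1 - \<theta>"] by auto
  obtain K where K: "compact K" "emeasure P\<^sub>0 (- K) = 0"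
    using assms(9) by (auto simp: compactly_supported_def)
  obtain R where R: "\<And>x. x \<in> K \<Longrightarrow> \<bar>x\<bar> \<le> R"
    using compact_imp_bounded[OF K(1)] by (auto simp: bounded_iff)
  have cont: "continuous_on UNIV h"
  proof -
    have "h differentiable (at x)" for x
      using assms(5)[unfolded smooth_function_def, rule_format, of 0 x] by simp
    then show ?thesis
      by (intro differentiable_imp_continuous_on) (simp add: differentiable_on_def)
  qed
  obtain C c where C: "C > 0" and c: "c > 0" and decay: "\<And>x. \<bar>h x\<bar> \<le> C * exp (- c * \<bar>x\<bar>)"
    using assms(6) by (auto simp: exponentially_decaying_def)
  \<comment> \<open>A condition on the potentials only; the shift \<open>b\<close> stays
    free.\<close>
  define good where "good \<omega> \<longleftrightarrow> (\<forall>j. typical_site P\<^sub>0 R (fst \<omega> j)) \<and> (\<forall>j. typical_site P\<^sub>0 R (snd \<omega> j)) \<and>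
    recurrent P\<^sub>0 (1 - \<theta>) \<omega>" for \<omega>
  have typical: "AE \<omega> in ?M. \<forall>j. typical_site P\<^sub>0 R (\<omega> j)"
    unfolding AE_all_countable site_product_def
    using AE_typical_site[OF assms(7,8) K(2,1) R] assms(7) by (intro allI AE_PiM_component) auto
  have "AE \<omega> in ?M \<Otimes>\<^sub>M ?M. recurrent P\<^sub>0 (1 - \<theta>) \<omega>"
    unfolding site_product_def by (rule AE_recurrent[OF assms(7,8) a])
  with AE_pair_fst[OF M.sigma_finite_measure_axioms typical] AE_pair_snd[OF M.sigma_finite_measure_axioms typical]
  have good: "AE \<omega> in ?M \<Otimes>\<^sub>M ?M. good \<omega>"
    by eventually_elim (simp add: good_def)
  have bounded: "\<bar>fst \<omega> n\<bar> \<le> R" "\<bar>snd \<omega> n\<bar> \<le> R" if "good \<omega>" for \<omega> n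
    using that by (auto simp: good_def typical_site_def)
  have subset: "coupled_chain_spectrum h \<theta> b' (fst \<omega>') (snd \<omega>') \<subseteq> coupled_chain_spectrum h \<theta> b (fst \<omega>) (snd \<omega>)"
    if "good \<omega>" "good \<omega>'" for b b' \<omega> \<omega>'
  proof (rule coupled_chain_spectrum_subset[OF assms(2,4) cont assms(6)])
    show "\<exists>k l. \<bar>b - of_int k + (1 - \<theta>) * of_int l - b'\<bar> < 1 / Suc N \<and>
      (\<forall>j. \<bar>j\<bar> \<le> int N \<longrightarrow> \<bar>fst \<omega> (j + k) - fst \<omega>' j\<bar> < 1 / Suc N \<and> \<bar>snd \<omega> (j + l) - snd \<omega>' j\<bar> < 1 / Suc N)" for N
      by (rule recurrent_approximates[where P = P\<^sub>0 and R = R]) (use that in \<open>auto simp: good_def\<close>)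
  qed (use bounded that in blast)+
  \<comment> \<open>A probability measure leaves some good potential. Its spectrum at
    \<open>b = 0\<close> is the reference; any other shift would do, because \<open>subset\<close>
    holds for all \<open>b\<close> and \<open>b'\<close>.\<close>
  obtain \<omega>\<^sub>0 where \<omega>\<^sub>0: "good \<omega>\<^sub>0"
    using good MM.AE_False by (metis (mono_tags, lifting) eventually_mono)
  define S where "S = {x. complex_of_real x \<in> coupled_chain_spectrum h \<theta> 0 (fst \<omega>\<^sub>0) (snd \<omega>\<^sub>0)}"
  obtain M where M: "schur_bounded M (chain_kernel h \<theta> 0 (fst \<omega>\<^sub>0) (snd \<omega>\<^sub>0))"
    using schur_bounded_chain_kernel[where \<omega>\<^sub>1 = "fst \<omega>\<^sub>0" and \<omega>\<^sub>2 = "snd \<omega>\<^sub>0" and b = 0,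
        OF assms(2,4) less_imp_le[OF C] c decay bounded[OF \<omega>\<^sub>0]] by blast
  have S: "coupled_chain_spectrum h \<theta> 0 (fst \<omega>\<^sub>0) (snd \<omega>\<^sub>0) = complex_of_real ` S"
    using coupled_chain_spectrum_real[OF assms(4) M] by (auto simp: S_def elim!: Reals_cases)
  have spectrum: "coupled_chain_spectrum h \<theta> b (fst \<omega>) (snd \<omega>) = complex_of_real ` S" if "good \<omega>" for b \<omega>
    using subset[OF that \<omega>\<^sub>0] subset[OF \<omega>\<^sub>0 that] unfolding S[symmetric] by blast
  obtain N where N: "{\<omega> \<in> space (?M \<Otimes>\<^sub>M ?M). \<not> good \<omega>} \<subseteq> N" "N \<in> null_sets (?M \<Otimes>\<^sub>M ?M)"
    using good unfolding eventually_ae_filter by blast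
  \<comment> \<open>\<open>sets P\<^sub>0 = sets borel\<close> makes the underlying space
    everything, so \<open>N\<close> catches every potential that is not good.\<close>
  have space: "space (?M \<Otimes>\<^sub>M ?M) = UNIV"
    using sets_eq_imp_space_eq[OF assms(8)] by (simp add: space_pair_measure site_product_def space_PiM)
  have "UNIV \<times> N \<in> null_sets (lborel \<Otimes>\<^sub>M (?M \<Otimes>\<^sub>M ?M))"
    by (rule MM.times_in_null_sets2[OF _ N(2)]) simp
  then have "UNIV \<times> N \<in> null_sets (parameter_measure P\<^sub>0)"
    unfolding parameter_measure_def by (rule null_sets_completionI)
  \<comment> \<open>The exceptional set is only placed inside a measurable null set; the completed
    measure turns this inclusion into nullity.\<close>
  moreover have "- {(b, \<omega>\<^sub>1, \<omega>\<^sub>2). coupled_chain_spectrum h \<theta> b \<omega>\<^sub>1 \<omega>\<^sub>2 = complex_of_real ` S} \<subseteq> UNIV \<times> N"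
    using spectrum N(1) unfolding space by force
  ultimately show ?thesis
    unfolding parameter_measure_def by (blast intro: null_sets_completion_subset)
qed

end
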